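(* Suppose that $f\in L^2(\mathbb R/\mathbb Z)$ satisfies $\int_0^1 f(x)\,dx=0$ and $$\sum_{n=1}^\infty\frac{\omega_2(2^{-n},f)}{\sqrt n}<\infty,$$ and that $(n_k)_{k\in\mathbb N}$ is a Hadamard lacunary sequence of positive integers. Then $\{f(n_kx)\}$ is a convergence system, i.e. for every complex sequence $(a_k)_{k\in\mathbb N}$ with $\sum_k|a_k|^2<\infty$ the series $\sum_{k=0}^\infty a_kf(n_kx)$ converges for Lebesgue-almost every $x$.
   Context: $\mathbb N=\{0,1,2,\dots\}$. Elements of $L^2(\mathbb R/\mathbb Z)$ are regarded as $1$-periodic functions on $\mathbb R$. A sequence of positive integers $(n_k)_{k\in\mathbb N}$ is Hadamard lacunary if there is $q>1$ with $\inf_k n_{k+1}/n_k\ge q$. The modulus of $L^2$-continuity is $\omega_2(\delta,f)=\sup_{0\le h\le\delta}\|f(\cdot+h)-f(\cdot)\|_2$. *)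

theory Defs
  imports "HOL-Analysis.Analysis"
begin

text \<open>
  Elements of \<open>L\<^sup>2(\<real>/\<int>)\<close> are represented by complex-valued, Lebesgue-measurable, everywhere
  1-periodic functions on the real line; no quotient by almost-everywhere equality is taken.
\<close>

definition L2_circle :: "(real \<Rightarrow> complex) set" where
  "L2_circle = {f. f \<in> borel_measurable lebesgue \<and> (\<forall>x. f (x + 1) = f x) \<and>
                   set_integrable lebesgue {0..1} (\<lambda>x. (cmod (f x))\<^sup>2)}"

definition L2_norm_circle :: "(real \<Rightarrow> complex) \<Rightarrow> real" where
  "L2_norm_circle f = sqrt (LINT x:{0..1}|lebesgue. (cmod (f x))\<^sup>2)"

text \<open>
  For \<open>f \<in> L2_circle\<close> and \<open>\<delta> \<ge> 0\<close> the set of norms below is nonempty and bounded by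
  \<open>2 * L2_norm_circle f\<close>, so the real-valued supremum is the true one.
\<close>

definition L2_modulus :: "real \<Rightarrow> (real \<Rightarrow> complex) \<Rightarrow> real" where
  "L2_modulus \<delta> f = (SUP h\<in>{0..\<delta>}. L2_norm_circle (\<lambda>x. f (x + h) - f x))"

definition hadamard_lacunary :: "(nat \<Rightarrow> nat) \<Rightarrow> bool" where
  "hadamard_lacunary n \<longleftrightarrow>
     (\<forall>k. n k > 0) \<and> (\<exists>q::real. q > 1 \<and> (INF k. real (n (Suc k)) / real (n k)) \<ge> q)"

definition convergence_system :: "(nat \<Rightarrow> real \<Rightarrow> complex) \<Rightarrow> bool" where
  "convergence_system \<phi> \<longleftrightarrow>
     (\<forall>a :: nat \<Rightarrow> complex. summable (\<lambda>k. (cmod (a k))\<^sup>2) \<longrightarrow>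
        (AE x in lebesgue. summable (\<lambda>k. a k * \<phi> k x)))"

end

theory Submission
  imports Defs
begin

text \<open>
  Suppose first that \<open>g\<close> is a step function with cells of length \<open>1/P\<close> and mean zero, and that it is dilated by
  integers \<open>N j\<close> which grow by a factor of at least \<open>P\<^sup>3\<close> in each step. Choose dyadic partitions with cells of
  length \<open>1 / Q j\<close> between the length of the steps of the dilation by \<open>N j\<close> and the period of the next
  one. Averaging over the cells of order \<open>Q i\<close> nearly reproduces the dilations with \<open>j \<le> i\<close>
  and nearly annihilates those with \<open>j > i\<close>, with errors that decay geometrically in \<open>\<bar>i - j\<bar>\<close>. So
  the partial sums of \<open>F x = (\<Sum>j. a j * g (N j * x))\<close> are essentially a martingale, and Doob's inequality
  (\<open>Doob_cell_mean\<close>) together with Schur's test for the errors bounds the largest partial sum in \<open>L\<^sup>2\<close> by a constant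
  times \<open>norm g * sqrt (\<Sum>j. (a j)\<^sup>2)\<close>; this is \<open>separated_dilations.maximal_inequality\<close>.

  If \<open>n\<close> is merely Hadamard lacunary and \<open>P = 2 ^ M\<close>, every residue class of the index modulo a multiple
  \<open>R\<close> of \<open>M\<close> is separated in this sense. Adding the maximal functions of the \<open>R\<close> classes loses a factor \<open>sqrt M\<close>
  (\<open>maximal_inequality_step\<close>).

  A general \<open>f\<close> is the sum of the differences of its averages over cells of length
  \<open>1 / 2 ^ 2 ^ m\<close>. The \<open>m\<close>-th difference is a step function with \<open>M = 2 ^ m\<close>, and its norm is controlled by the
  modulus of continuity at the coarser of the two scales. The maximal inequality therefore holds for \<open>f\<close> if the sum
  of \<open>sqrt (2 ^ m) * \<omega> (1 / 2 ^ 2 ^ m)\<close> converges (\<open>maximal_inequality_modulus\<close>), and by Cauchy condensation this is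
  the hypothesis of the theorem. The maximal inequality for the tails of the series yields the Cauchy
  criterion almost everywhere (\<open>AE_summable_of_maximal_inequality\<close>).
\<close>

section \<open>Lebesgue measure on one period\<close>

definition circle :: "real measure" where
  "circle = restrict_space lborel {0..<1}"

lemma space_circle [simp]: "space circle = {0..<1}"
  by (simp add: circle_def space_restrict_space)

lemma borel_measurable_frac [measurable]: "(frac :: real \<Rightarrow> real) \<in> borel_measurable borel"
  unfolding frac_def [abs_def] by measurable

lemma measurable_circle: "f \<in> borel_measurable borel \<Longrightarrow> f \<in> borel_measurable circle"
  unfolding circle_def by (rule measurable_restrict_space1) simp

lemma measurable_ident_circle [measurable]: "(\<lambda>x. x) \<in> circle \<rightarrow>\<^sub>M borel"
  unfolding circle_def by (rule measurable_restrict_space1) simp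

lemma nn_integral_circle:
  "(\<integral>\<^sup>+x. f x \<partial>circle) = (\<integral>\<^sup>+x. f x * indicator {0..<1} x \<partial>lborel)"
  by (simp add: circle_def nn_integral_restrict_space)

lemma emeasure_circle: 
  assumes "A \<in> sets borel" "A \<subseteq> {0..<1}"
  shows "emeasure circle A = emeasure lborel A"
  using assms by (simp add: circle_def emeasure_restrict_space)

interpretation circle: finite_measure circle
  by standard (simp add: emeasure_circle)

lemma emeasure_space_circle: "emeasure circle (space circle) = 1"
  by (simp add: emeasure_circle)

lemma emeasure_circle_unit [simp]: "emeasure circle {0..<1} = 1"
  by (simp add: emeasure_circle)

lemma measure_space_circle [simp]: "measure circle {0..<1} = 1"
  by (simp add: measure_def)

interpretation circle2: pair_sigma_finite circle circle ..

lemma nn_integral_const_circle [simp]: "(\<integral>\<^sup>+x. c \<partial>circle) = c"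
  using emeasure_space_circle by simp

lemma nn_integral_lborel_shift:
  fixes v :: "real \<Rightarrow> ennreal"
  assumes [measurable]: "v \<in> borel_measurable borel"
  shows "(\<integral>\<^sup>+x. v (x + h) \<partial>lborel) = (\<integral>\<^sup>+x. v x \<partial>lborel)"
  using nn_integral_real_affine[of v 1 h] by (simp add: add.commute)

lemma periodic_add_nat:
  fixes v :: "real \<Rightarrow> 'a"
  assumes "\<And>x. v (x + 1) = v x"
  shows "v (x + real i) = v x"
proof (induction i)
  case (Suc i)
  have "v (x + real (Suc i)) = v ((x + real i) + 1)" by (simp add: algebra_simps)
  with Suc show ?case by (simp add: assms)
qed simp

lemma periodic_add_int:
  fixes v :: "real \<Rightarrow> 'a"
  assumes "\<And>x. v (x + 1) = v x"
  shows "v (x + of_int i) = v x"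
proof (cases "i \<ge> 0")
  case True
  then show ?thesis using periodic_add_nat[of v x "nat i"] assms by simp
next
  case False
  then show ?thesis using periodic_add_nat[of v "x + of_int i" "nat (-i)"] assms by simp
qed

lemma periodic_mult_nat:
  fixes v :: "real \<Rightarrow> 'a"
  assumes "\<And>x. v (x + 1) = v x"
  shows "v (real n * (x + 1)) = v (real n * x)"
  using periodic_add_nat[of v "real n * x" n] assms by (simp add: algebra_simps)

text \<open>
  The piece of \<open>[h, 1 + h)\<close> that sticks out of the unit interval is moved back by one period.
\<close>

lemma nn_integral_circle_shift_pos:
  fixes v :: "real \<Rightarrow> ennreal"
  assumes [measurable]: "v \<in> borel_measurable borel" and per: "\<And>x. v (x + 1) = v x"
    and h: "0 \<le> h" "h \<le> 1"
  shows "(\<integral>\<^sup>+x. v (x + h) \<partial>circle) = (\<integral>\<^sup>+x. v x \<partial>circle)"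
proof -
  have "(\<integral>\<^sup>+x. v (x + h) \<partial>circle) = (\<integral>\<^sup>+x. v (x + h) * indicator {h..<1+h} (x + h) \<partial>lborel)"
    unfolding nn_integral_circle by (intro nn_integral_cong) (auto simp: indicator_def)
  also have "\<dots> = (\<integral>\<^sup>+x. v x * indicator {h..<1+h} x \<partial>lborel)"
    using nn_integral_lborel_shift[of "\<lambda>y. v y * indicator {h..<1+h} y" h] by simp
  also have "\<dots> = (\<integral>\<^sup>+x. v x * indicator {h..<1} x + v x * indicator {1..<1+h} x \<partial>lborel)"
    using h by (intro nn_integral_cong) (auto simp: indicator_def)
  also have "\<dots> = (\<integral>\<^sup>+x. v x * indicator {h..<1} x \<partial>lborel) + (\<integral>\<^sup>+x. v x * indicator {1..<1+h} x \<partial>lborel)"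
    by (rule nn_integral_add) auto
  also have "(\<integral>\<^sup>+x. v x * indicator {1..<1+h} x \<partial>lborel) = (\<integral>\<^sup>+x. v (x + 1) * indicator {1..<1+h} (x + 1) \<partial>lborel)"
    using nn_integral_lborel_shift[of "\<lambda>y. v y * indicator {1..<1+h} y" 1] by simp
  also have "\<dots> = (\<integral>\<^sup>+x. v x * indicator {0..<h} x \<partial>lborel)"
    by (intro nn_integral_cong) (auto simp: indicator_def per)
  also have "(\<integral>\<^sup>+x. v x * indicator {h..<1} x \<partial>lborel) + (\<integral>\<^sup>+x. v x * indicator {0..<h} x \<partial>lborel)
     = (\<integral>\<^sup>+x. v x * indicator {h..<1} x + v x * indicator {0..<h} x \<partial>lborel)"
    by (rule nn_integral_add[symmetric]) auto
  also have "\<dots> = (\<integral>\<^sup>+x. v x * indicator {0..<1} x \<partial>lborel)"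
    using h by (intro nn_integral_cong) (auto simp: indicator_def)
  finally show ?thesis by (simp add: nn_integral_circle)
qed

lemma nn_integral_circle_shift:
  fixes v :: "real \<Rightarrow> ennreal"
  assumes m: "v \<in> borel_measurable borel" and per: "\<And>x. v (x + 1) = v x"
    and h: "\<bar>h\<bar> \<le> 1"
  shows "(\<integral>\<^sup>+x. v (x + h) \<partial>circle) = (\<integral>\<^sup>+x. v x \<partial>circle)"
proof (cases "h \<ge> 0")
  case True
  then show ?thesis using nn_integral_circle_shift_pos[OF m per] h by simp
next
  case False
  have "(\<integral>\<^sup>+x. v ((x + - h) + h) \<partial>circle) = (\<integral>\<^sup>+x. v (x + h) \<partial>circle)"
  proof (rule nn_integral_circle_shift_pos[of "\<lambda>x. v (x + h)"])
    show "(\<lambda>x. v (x + h)) \<in> borel_measurable borel" using m by measurable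
    show "v (x + 1 + h) = v (x + h)" for x using per[of "x + h"] by (simp add: algebra_simps)
  qed (use False h in auto)
  then show ?thesis by simp
qed

section \<open>Step functions and dilations\<close>

text \<open>
  The cells of order \<open>P\<close> are the intervals \<open>[i/P, (i+1)/P)\<close>. Recognising a cell by the value of
  \<open>\<lfloor>P x\<rfloor>\<close> avoids partitions and indices altogether.
\<close>

definition cell_step :: "nat \<Rightarrow> (real \<Rightarrow> 'a) \<Rightarrow> bool" where
  "cell_step P g \<longleftrightarrow> (\<forall>x y. \<lfloor>real P * x\<rfloor> = \<lfloor>real P * y\<rfloor> \<longrightarrow> g x = g y)"

lemma cell_stepD: "cell_step P g \<Longrightarrow> \<lfloor>real P * x\<rfloor> = \<lfloor>real P * y\<rfloor> \<Longrightarrow> g x = g y"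
  unfolding cell_step_def by blast

text \<open>
  A step function of order \<open>N\<close> and a dilation by \<open>N\<close> of a periodic function are independent: on every
  cell the dilation runs through exactly one full period. This independence takes the place of Fourier
  analysis in all estimates for dilations.
\<close>

lemma nn_integral_circle_step_dilation:
  fixes \<phi> \<psi> :: "real \<Rightarrow> ennreal"
  assumes [measurable]: "\<phi> \<in> borel_measurable borel" "\<psi> \<in> borel_measurable borel"
    and per: "\<And>x. \<psi> (x + 1) = \<psi> x" and step: "cell_step N \<phi>" and N: "N > 0"
  shows "(\<integral>\<^sup>+x. \<phi> x * \<psi> (real N * x) \<partial>circle) = (\<integral>\<^sup>+x. \<phi> x \<partial>circle) * (\<integral>\<^sup>+x. \<psi> x \<partial>circle)"
proof -
  have *: "(\<integral>\<^sup>+x. \<phi> x * \<xi> (real N * x) \<partial>circle) = ennreal (1/N) * (\<Sum>i<N. \<phi> (real i / N)) * (\<integral>\<^sup>+x. \<xi> x \<partial>circle)"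
    if [measurable]: "\<xi> \<in> borel_measurable borel" and per: "\<And>x. \<xi> (x + 1) = \<xi> x" for \<xi> :: "real \<Rightarrow> ennreal"
  proof -
    have part: "indicator {0..<real n} x = (\<Sum>i<n. indicator {real i..<real i+1} x :: ennreal)" for x n
      by (induction n) (auto simp: indicator_def split: if_splits)
    have "(\<integral>\<^sup>+x. \<phi> x * \<xi> (real N * x) \<partial>circle)
       = ennreal (1/N) * (\<integral>\<^sup>+y. \<phi> (y / N) * \<xi> y * indicator {0..<1} (y/N) \<partial>lborel)"
      unfolding nn_integral_circle
      using nn_integral_real_affine[of "\<lambda>x. \<phi> x * \<xi> (real N * x) * indicator {0..<1} x" "1/N" 0] N
      by simp
    also have "(\<integral>\<^sup>+y. \<phi> (y / N) * \<xi> y * indicator {0..<1} (y/N) \<partial>lborel)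
        = (\<integral>\<^sup>+y. (\<Sum>i<N. \<phi> (y / N) * \<xi> y * indicator {real i..<real i+1} y) \<partial>lborel)"
    proof (rule nn_integral_cong)
      fix y
      have "indicator {0..<1} (y/N) = (indicator {0..<real N} y :: ennreal)"
        using N by (auto simp: indicator_def field_simps)
      then show "\<phi> (y / N) * \<xi> y * indicator {0..<1} (y/N) = (\<Sum>i<N. \<phi> (y / N) * \<xi> y * indicator {real i..<real i+1} y)"
        by (simp add: part sum_distrib_left)
    qed
    also have "\<dots> = (\<Sum>i<N. (\<integral>\<^sup>+y. \<phi> (y / N) * \<xi> y * indicator {real i..<real i+1} y \<partial>lborel))"
      by (rule nn_integral_sum) simp
    also have "\<dots> = (\<Sum>i<N. \<phi> (real i / N) * (\<integral>\<^sup>+x. \<xi> x \<partial>circle))"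
    proof (rule sum.cong[OF refl])
      fix i
      have "(\<integral>\<^sup>+y. \<phi> (y / N) * \<xi> y * indicator {real i..<real i+1} y \<partial>lborel)
          = (\<integral>\<^sup>+y. \<phi> (real i / N) * (\<xi> y * indicator {real i..<real i+1} y) \<partial>lborel)"
      proof (rule nn_integral_cong)
        fix y
        show "\<phi> (y / N) * \<xi> y * indicator {real i..<real i+1} y = \<phi> (real i / N) * (\<xi> y * indicator {real i..<real i+1} y)"
        proof (cases "y \<in> {real i..<real i+1}")
          case True
          then have "\<lfloor>real N * (y / N)\<rfloor> = \<lfloor>real N * (real i / N)\<rfloor>" using N by (simp add: floor_eq_iff)
          from cell_stepD[OF step this] show ?thesis by (simp add: mult.assoc)
        qed simp
      qed
      also have "\<dots> = \<phi> (real i / N) * (\<integral>\<^sup>+y. \<xi> y * indicator {real i..<real i+1} y \<partial>lborel)"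
        by (rule nn_integral_cmult) simp
      also have "(\<integral>\<^sup>+y. \<xi> y * indicator {real i..<real i+1} y \<partial>lborel)
          = (\<integral>\<^sup>+y. \<xi> (y + real i) * indicator {real i..<real i+1} (y + real i) \<partial>lborel)"
        using nn_integral_lborel_shift[of "\<lambda>y. \<xi> y * indicator {real i..<real i+1} y" "real i"] by simp
      also have "\<dots> = (\<integral>\<^sup>+x. \<xi> x \<partial>circle)"
        unfolding nn_integral_circle
        by (intro nn_integral_cong) (auto simp: indicator_def periodic_add_nat[of \<xi>, OF per])
      finally show "(\<integral>\<^sup>+y. \<phi> (y / N) * \<xi> y * indicator {real i..<real i+1} y \<partial>lborel) = \<phi> (real i / N) * (\<integral>\<^sup>+x. \<xi> x \<partial>circle)" .
    qed
    also have "ennreal (1/N) * (\<Sum>i<N. \<phi> (real i / N) * (\<integral>\<^sup>+x. \<xi> x \<partial>circle)) = ennreal (1/N) * (\<Sum>i<N. \<phi> (real i / N)) * (\<integral>\<^sup>+x. \<xi> x \<partial>circle)"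
      by (simp add: sum_distrib_right[symmetric] mult.assoc)
    finally show ?thesis .
  qed
  show ?thesis using *[of \<psi>] *[of "\<lambda>_. 1"] per by simp
qed

lemma cell_step_const [simp]: "cell_step P (\<lambda>_. c)"
  by (simp add: cell_step_def)

lemma nn_integral_circle_dilation:
  fixes \<psi> :: "real \<Rightarrow> ennreal"
  assumes "\<psi> \<in> borel_measurable borel" "\<And>x. \<psi> (x + 1) = \<psi> x" "N > 0"
  shows "(\<integral>\<^sup>+x. \<psi> (real N * x) \<partial>circle) = (\<integral>\<^sup>+x. \<psi> x \<partial>circle)"
  using nn_integral_circle_step_dilation[of "\<lambda>_. 1" \<psi> N] assms by (simp add: cell_step_const)

lemma integral_circle_step_dilation:
  fixes \<phi> \<psi> :: "real \<Rightarrow> real"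
  assumes [measurable]: "\<phi> \<in> borel_measurable borel" "\<psi> \<in> borel_measurable borel"
    and per: "\<And>x. \<psi> (x + 1) = \<psi> x" and step: "cell_step N \<phi>" and N: "N > 0"
    and "\<And>x. \<phi> x \<ge> 0" and "integrable circle \<phi>" "integrable circle \<psi>"
  shows "integrable circle (\<lambda>x. \<phi> x * \<psi> (real N * x))"
    and "(LINT x|circle. \<phi> x * \<psi> (real N * x)) = (LINT x|circle. \<phi> x) * (LINT x|circle. \<psi> x)"
proof -
  have fin: "(\<integral>\<^sup>+x. ennreal (\<phi> x) \<partial>circle) \<noteq> \<infinity>" "(\<integral>\<^sup>+x. ennreal (\<psi> x) \<partial>circle) \<noteq> \<infinity>" "(\<integral>\<^sup>+x. ennreal (- \<psi> x) \<partial>circle) \<noteq> \<infinity>"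
    using assms(7,8) by (auto simp: real_integrable_def)
  have s: "cell_step N (\<lambda>x. ennreal (\<phi> x))" using step unfolding cell_step_def by metis
  have 1: "(\<integral>\<^sup>+x. ennreal (\<phi> x * \<psi> (real N * x)) \<partial>circle) = (\<integral>\<^sup>+x. ennreal (\<phi> x) \<partial>circle) * (\<integral>\<^sup>+x. ennreal (\<psi> x) \<partial>circle)"
    using nn_integral_circle_step_dilation[of "\<lambda>x. ennreal (\<phi> x)" "\<lambda>x. ennreal (\<psi> x)" N] s per N assms(6)
    by (simp add: ennreal_mult')
  have 2: "(\<integral>\<^sup>+x. ennreal (- (\<phi> x * \<psi> (real N * x))) \<partial>circle) = (\<integral>\<^sup>+x. ennreal (\<phi> x) \<partial>circle) * (\<integral>\<^sup>+x. ennreal (- \<psi> x) \<partial>circle)"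
  proof -
    have "ennreal (- (\<phi> x * \<psi> (real N * x))) = ennreal (\<phi> x) * ennreal (- \<psi> (real N * x))" for x
      using ennreal_mult'[of "\<phi> x" "- \<psi> (real N * x)"] assms(6) by simp
    then show ?thesis
      using nn_integral_circle_step_dilation[of "\<lambda>x. ennreal (\<phi> x)" "\<lambda>x. ennreal (- \<psi> x)" N] s per N
      by simp
  qed
  show int: "integrable circle (\<lambda>x. \<phi> x * \<psi> (real N * x))"
    unfolding real_integrable_def 1 2 using fin by (auto simp: ennreal_mult_eq_top_iff)
  have phi: "(LINT x|circle. \<phi> x) = enn2real (\<integral>\<^sup>+x. ennreal (\<phi> x) \<partial>circle)"
    using assms(6) by (intro integral_eq_nn_integral) auto
  show "(LINT x|circle. \<phi> x * \<psi> (real N * x)) = (LINT x|circle. \<phi> x) * (LINT x|circle. \<psi> x)"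
    unfolding real_lebesgue_integral_def[OF int] 1 2 phi real_lebesgue_integral_def[OF assms(8)]
    by (simp add: enn2real_mult right_diff_distrib)
qed


lemma floor_mult_frac: "\<lfloor>real P * frac x\<rfloor> = \<lfloor>real P * x\<rfloor> - int P * \<lfloor>x\<rfloor>"
proof -
  have "real P * frac x = real P * x - of_int (int P * \<lfloor>x\<rfloor>)"
    by (simp add: frac_def algebra_simps)
  then show ?thesis by (simp only: floor_diff_of_int)
qed

lemma floor_mult_div:
  assumes "k > 0" shows "\<lfloor>real k * x\<rfloor> div int k = \<lfloor>x\<rfloor>"
  using floor_divide_real_eq_div[of "int k" "real k * x"] assms by simp

lemma cell_step_dvd:
  assumes "cell_step P g" "P dvd Q" "Q > 0" shows "cell_step Q g"
  unfolding cell_step_def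
proof (intro allI impI)
  fix x y assume xy: "\<lfloor>real Q * x\<rfloor> = \<lfloor>real Q * y\<rfloor>"
  from assms obtain k where k: "Q = k * P" by (auto simp: mult.commute elim: dvdE)
  with assms have "k > 0" by auto
  with k xy have "\<lfloor>real P * x\<rfloor> = \<lfloor>real P * y\<rfloor>"
    using floor_mult_div[of k "real P * x"] floor_mult_div[of k "real P * y"] by (simp add: mult.assoc)
  then show "g x = g y" using assms(1) cell_stepD by metis
qed

lemma cell_step_dilation:
  "cell_step P g \<Longrightarrow> cell_step (P * N) (\<lambda>x. g (real N * x))"
  unfolding cell_step_def of_nat_mult mult.assoc by blast

lemma cell_step_floor: "cell_step P (\<lambda>x. h \<lfloor>real P * x\<rfloor>)"
  unfolding cell_step_def by simp

lemma cell_step_compose2: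
  "cell_step P g \<Longrightarrow> cell_step P g' \<Longrightarrow> cell_step P (\<lambda>x. h (g x) (g' x))"
  unfolding cell_step_def by metis

lemma cell_step_compose: "cell_step P g \<Longrightarrow> cell_step P (\<lambda>x. h (g x))"
  unfolding cell_step_def by metis

lemma integrable_circle_bounded:
  fixes f :: "real \<Rightarrow> real"
  assumes "f \<in> borel_measurable borel" "\<And>x. \<bar>f x\<bar> \<le> C"
  shows "integrable circle f"
  using assms by (intro circle.integrable_const_bound[where B = C] measurable_circle) auto

lemma integral_circle_cell:
  assumes "0 \<le> k" "k < int P"
  shows "(LINT y|circle. (if \<lfloor>real P * y\<rfloor> = k then 1 else 0)) = (1 / real P :: real)"
proof -
  have P: "P > 0" using assms by simp
  have iff: "\<lfloor>real P * y\<rfloor> = k \<longleftrightarrow> y \<in> {of_int k / P..<(of_int k + 1) / P}" for y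
    using P by (auto simp: floor_eq_iff field_simps)
  have sub: "{of_int k / P..<(of_int k + 1) / P} \<subseteq> {0..<1::real}"
  proof -
    have "real_of_int k + 1 \<le> real P" "real_of_int k \<ge> 0" using assms by linarith+
    then have "(of_int k + 1) / real P \<le> 1" "real_of_int k / P \<ge> 0" using P by (auto simp: field_simps)
    then show ?thesis by auto
  qed
  have "(LINT y|circle. (if \<lfloor>real P * y\<rfloor> = k then 1 else 0)) = (LINT y|circle. indicator {of_int k / P..<(of_int k + 1) / P} y :: real)"
    by (rule Bochner_Integration.integral_cong) (auto simp: iff indicator_def)
  also have "\<dots> = measure circle {of_int k / P..<(of_int k + 1) / P}"
    using Int_absorb2[OF sub] by (simp only: Bochner_Integration.integral_indicator space_circle)
  also have "\<dots> = measure lborel {of_int k / P..<(of_int k + 1) / P}"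
    using sub by (simp add: measure_def emeasure_circle)
  also have "\<dots> = 1 / P" using P by (simp add: field_simps)
  finally show ?thesis .
qed

section \<open>Bounds in quadratic mean\<close>

text \<open>
  An upper bound for the \<open>L\<^sup>2\<close> norm over a period. A relation is more convenient than a norm here: one
  never has to compute a norm, integrability is part of the bound, and the triangle inequality and
  its relatives become closure rules.
\<close>

definition L2le :: "(real \<Rightarrow> real) \<Rightarrow> real \<Rightarrow> bool" where
  "L2le u c \<longleftrightarrow> u \<in> borel_measurable borel \<and> 0 \<le> c \<and> (\<integral>\<^sup>+x. ennreal ((u x)\<^sup>2) \<partial>circle) \<le> ennreal (c\<^sup>2)"

lemma L2le_measurable: "L2le u c \<Longrightarrow> u \<in> borel_measurable borel"
  by (simp add: L2le_def)

lemma L2le_nonneg: "L2le u c \<Longrightarrow> 0 \<le> c"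
  by (simp add: L2le_def)

lemma L2le_integrable_square:
  assumes "L2le u c" shows "integrable circle (\<lambda>x. (u x)\<^sup>2)"
proof (rule integrableI_bounded)
  have [measurable]: "u \<in> borel_measurable borel" using assms by (simp add: L2le_def)
  show "(\<lambda>x. (u x)\<^sup>2) \<in> borel_measurable circle" by measurable
  show "(\<integral>\<^sup>+x. ennreal (norm ((u x)\<^sup>2)) \<partial>circle) < \<infinity>"
    using assms by (auto simp: L2le_def intro: le_less_trans)
qed

lemma L2le_integral_square:
  assumes "L2le u c" shows "(LINT x|circle. (u x)\<^sup>2) \<le> c\<^sup>2"
proof -
  have "ennreal (LINT x|circle. (u x)\<^sup>2) \<le> ennreal (c\<^sup>2)"
    using assms nn_integral_eq_integral[OF L2le_integrable_square[OF assms]] by (simp add: L2le_def)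
  then show ?thesis by (simp add: ennreal_le_iff)
qed

lemma L2leI:
  assumes "u \<in> borel_measurable borel" "0 \<le> c" "integrable circle (\<lambda>x. (u x)\<^sup>2)" "(LINT x|circle. (u x)\<^sup>2) \<le> c\<^sup>2"
  shows "L2le u c"
  using assms nn_integral_eq_integral[OF assms(3)] by (simp add: L2le_def ennreal_le_iff)

lemma L2le_integrable:
  assumes "L2le u c" shows "integrable circle u"
proof (rule Bochner_Integration.integrable_bound)
  show "integrable circle (\<lambda>x. 1 + (u x)\<^sup>2)" using L2le_integrable_square[OF assms] by simp
  show "u \<in> borel_measurable circle" using L2le_measurable[OF assms] by (rule measurable_circle)
  have "\<bar>u x\<bar> \<le> 1 + (u x)\<^sup>2" for x
  proof -
    have "0 \<le> (\<bar>u x\<bar> - 1)\<^sup>2" by simp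
    then show ?thesis by (simp add: power2_eq_square algebra_simps)
  qed
  then show "AE x in circle. norm (u x) \<le> norm (1 + (u x)\<^sup>2)" by simp
qed

lemma L2le_mono:
  assumes "L2le v c" "u \<in> borel_measurable borel" "\<And>x. 0 \<le> x \<Longrightarrow> x < 1 \<Longrightarrow> \<bar>u x\<bar> \<le> \<bar>v x\<bar>" "c \<le> d"
  shows "L2le u d"
proof -
  have "(\<integral>\<^sup>+x. ennreal ((u x)\<^sup>2) \<partial>circle) \<le> (\<integral>\<^sup>+x. ennreal ((v x)\<^sup>2) \<partial>circle)"
    using assms(3) by (intro nn_integral_mono ennreal_leI) (simp add: abs_le_square_iff)
  also have "\<dots> \<le> ennreal (c\<^sup>2)" using assms by (simp add: L2le_def)
  also have "\<dots> \<le> ennreal (d\<^sup>2)" using assms by (intro ennreal_leI power_mono) (auto simp: L2le_def)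
  finally show ?thesis using assms by (auto simp: L2le_def)
qed

lemma L2le_weaken: "L2le u c \<Longrightarrow> c \<le> d \<Longrightarrow> L2le u d"
  by (rule L2le_mono) (auto simp: L2le_def)

lemma L2le_abs: "L2le u c \<Longrightarrow> L2le (\<lambda>x. \<bar>u x\<bar>) c"
  by (rule L2le_mono) (auto simp: L2le_def)

lemma L2le_scale:
  assumes "L2le u c" shows "L2le (\<lambda>x. a * u x) (\<bar>a\<bar> * c)"
proof (rule L2leI)
  have [measurable]: "u \<in> borel_measurable borel" using assms by (simp add: L2le_def)
  show "(\<lambda>x. a * u x) \<in> borel_measurable borel" by measurable
  show "integrable circle (\<lambda>x. (a * u x)\<^sup>2)"
    using L2le_integrable_square[OF assms] by (simp add: power_mult_distrib)
  show "(LINT x|circle. (a * u x)\<^sup>2) \<le> (\<bar>a\<bar> * c)\<^sup>2"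
    using L2le_integral_square[OF assms] by (simp add: power_mult_distrib mult_left_mono)
  show "0 \<le> \<bar>a\<bar> * c" using L2le_nonneg[OF assms] by simp
qed

text \<open>
  A pointwise inequality whose integrated form, with the weights \<open>c\<close> and \<open>d\<close> taken to be the bounds for
  the two summands, is the Minkowski inequality.
\<close>

lemma weighted_square_add:
  fixes u v c d :: real
  assumes "c > 0" "d > 0"
  shows "(u + v)\<^sup>2 \<le> (c + d) * (u\<^sup>2 / c + v\<^sup>2 / d)"
proof -
  have "(c + d) * (u\<^sup>2 / c + v\<^sup>2 / d) - (u + v)\<^sup>2 = (d * u - c * v)\<^sup>2 / (c * d)"
    using assms by (simp add: field_simps power2_eq_square)
  also have "\<dots> \<ge> 0" using assms by simp
  finally show ?thesis by simp
qed

lemma L2le_add: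
  assumes u: "L2le u c" and v: "L2le v d" shows "L2le (\<lambda>x. u x + v x) (c + d)"
proof (rule L2leI)
  have [measurable]: "u \<in> borel_measurable borel" "v \<in> borel_measurable borel" using assms by (auto simp: L2le_def)
  have cd: "0 \<le> c" "0 \<le> d" using assms by (auto simp: L2le_def)
  note int = L2le_integrable_square[OF u] L2le_integrable_square[OF v]
  show "(\<lambda>x. u x + v x) \<in> borel_measurable borel" by measurable
  show "0 \<le> c + d" using cd by simp
  show i: "integrable circle (\<lambda>x. (u x + v x)\<^sup>2)"
  proof (rule Bochner_Integration.integrable_bound)
    show "integrable circle (\<lambda>x. 2 * ((u x)\<^sup>2 + (v x)\<^sup>2))" using int by simp
    show "(\<lambda>x. (u x + v x)\<^sup>2) \<in> borel_measurable circle" by measurable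
    show "AE x in circle. norm ((u x + v x)\<^sup>2) \<le> norm (2 * ((u x)\<^sup>2 + (v x)\<^sup>2))"
      using weighted_square_add[of 1 1] by simp
  qed
  have nn: "(LINT x|circle. (u x + v x)\<^sup>2) \<ge> 0" by simp
  have "sqrt (LINT x|circle. (u x + v x)\<^sup>2) \<le> c + d"
  proof (rule field_le_epsilon)
    fix e :: real assume e: "e > 0"
    \<comment> \<open>The weights have to be positive, so both bounds are first enlarged a little.\<close>
    define c' d' where "c' = c + e/2" and "d' = d + e/2"
    have pos: "c' > 0" "d' > 0" using cd e by (auto simp: c'_def d'_def)
    have c2: "c\<^sup>2 \<le> c'\<^sup>2" and d2: "d\<^sup>2 \<le> d'\<^sup>2"
      using cd e by (auto simp: c'_def d'_def intro!: power_mono)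
    have "(LINT x|circle. (u x + v x)\<^sup>2) \<le> (LINT x|circle. (c' + d') * ((u x)\<^sup>2 / c' + (v x)\<^sup>2 / d'))"
      using i int weighted_square_add[OF pos] by (intro integral_mono) auto
    also have "\<dots> = (c' + d') * ((LINT x|circle. (u x)\<^sup>2) / c' + (LINT x|circle. (v x)\<^sup>2) / d')"
      using int by simp
    also have "\<dots> \<le> (c' + d') * (c'\<^sup>2 / c' + d'\<^sup>2 / d')"
    proof (intro mult_left_mono add_mono divide_right_mono)
      show "(LINT x|circle. (u x)\<^sup>2) \<le> c'\<^sup>2" using L2le_integral_square[OF u] c2 by linarith
      show "(LINT x|circle. (v x)\<^sup>2) \<le> d'\<^sup>2" using L2le_integral_square[OF v] d2 by linarith
    qed (use pos in auto)
    also have "\<dots> = (c' + d')\<^sup>2" using pos by (simp add: power2_eq_square)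
    also have "c' + d' = c + d + e" by (simp add: c'_def d'_def)
    finally show "sqrt (LINT x|circle. (u x + v x)\<^sup>2) \<le> c + d + e"
      using cd e by (intro real_le_lsqrt) auto
  qed
  then show "(LINT x|circle. (u x + v x)\<^sup>2) \<le> (c + d)\<^sup>2"
    using cd by (simp add: sqrt_le_D)
qed

lemma L2le_zero: "L2le (\<lambda>_. 0) 0"
  by (simp add: L2le_def)

lemma L2le_diff:
  assumes "L2le u c" "L2le v d" shows "L2le (\<lambda>x. u x - v x) (c + d)"
  using L2le_add[OF assms(1) L2le_scale[OF assms(2), of "-1"]] by simp

lemma L2le_sum:
  assumes "finite I" "\<And>i. i \<in> I \<Longrightarrow> L2le (u i) (c i)"
  shows "L2le (\<lambda>x. \<Sum>i\<in>I. u i x) (\<Sum>i\<in>I. c i)"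
  using assms by (induction I rule: finite_induct) (auto simp: L2le_zero intro: L2le_add)

lemma L2le_const_bound:
  assumes "u \<in> borel_measurable borel" "\<And>x. \<bar>u x\<bar> \<le> C"
  shows "L2le u C"
proof -
  have C: "0 \<le> C" using assms(2)[of 0] by linarith
  then have "L2le (\<lambda>_. C) C" by (simp add: L2le_def)
  then show ?thesis using assms C by (elim L2le_mono) auto
qed

lemma L2le_square_sum:
  assumes "finite I" "\<And>i. i \<in> I \<Longrightarrow> L2le (u i) (c i)"
  shows "L2le (\<lambda>x. sqrt (\<Sum>i\<in>I. (u i x)\<^sup>2)) (sqrt (\<Sum>i\<in>I. (c i)\<^sup>2))"
proof (rule L2leI)
  have [measurable]: "u i \<in> borel_measurable borel" if "i \<in> I" for i using assms that by (auto simp: L2le_def)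
  show "(\<lambda>x. sqrt (\<Sum>i\<in>I. (u i x)\<^sup>2)) \<in> borel_measurable borel" by measurable
  show "0 \<le> sqrt (\<Sum>i\<in>I. (c i)\<^sup>2)" by (simp add: sum_nonneg)
  have eq: "(sqrt (\<Sum>i\<in>I. (u i x)\<^sup>2))\<^sup>2 = (\<Sum>i\<in>I. (u i x)\<^sup>2)" for x
    by (simp add: sum_nonneg)
  show "integrable circle (\<lambda>x. (sqrt (\<Sum>i\<in>I. (u i x)\<^sup>2))\<^sup>2)"
    unfolding eq using L2le_integrable_square[OF assms(2)] by (intro Bochner_Integration.integrable_sum) auto
  have "(LINT x|circle. (\<Sum>i\<in>I. (u i x)\<^sup>2)) = (\<Sum>i\<in>I. LINT x|circle. (u i x)\<^sup>2)"
    using L2le_integrable_square[OF assms(2)] by (intro Bochner_Integration.integral_sum) auto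
  also have "\<dots> \<le> (\<Sum>i\<in>I. (c i)\<^sup>2)" by (intro sum_mono L2le_integral_square assms)
  finally show "(LINT x|circle. (sqrt (\<Sum>i\<in>I. (u i x)\<^sup>2))\<^sup>2) \<le> (sqrt (\<Sum>i\<in>I. (c i)\<^sup>2))\<^sup>2"
    unfolding eq by (simp add: sum_nonneg)
qed

lemma L2le_integral_abs:
  assumes "L2le u c" shows "(LINT x|circle. \<bar>u x\<bar>) \<le> c"
proof -
  define m where "m = (LINT x|circle. \<bar>u x\<bar>)"
  have [simp]: "integrable circle u" "integrable circle (\<lambda>x. (u x)\<^sup>2)"
    using assms L2le_integrable L2le_integrable_square by auto
  \<comment> \<open>The variance of the modulus is nonnegative.\<close>
  have "0 \<le> (LINT x|circle. (\<bar>u x\<bar> - m)\<^sup>2)" by simp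
  also have "\<dots> = (LINT x|circle. (u x)\<^sup>2 - 2 * m * \<bar>u x\<bar> + m\<^sup>2)"
    by (simp add: power2_diff mult.assoc mult.commute)
  also have "\<dots> = (LINT x|circle. (u x)\<^sup>2) - 2 * m * m + m\<^sup>2"
    by (simp add: m_def)
  also have "\<dots> \<le> c\<^sup>2 - m\<^sup>2" using L2le_integral_square[OF assms] by (simp add: power2_eq_square)
  finally have "m\<^sup>2 \<le> c\<^sup>2" by simp
  then show ?thesis using L2le_nonneg[OF assms] power2_le_imp_le unfolding m_def by blast
qed

lemma L2le_shift:
  assumes "L2le u c" "\<And>x. u (x + 1) = u x" "\<bar>h\<bar> \<le> 1"
  shows "L2le (\<lambda>x. u (x + h)) c"
  using assms nn_integral_circle_shift[of "\<lambda>x. ennreal ((u x)\<^sup>2)" h] by (auto simp: L2le_def)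

section \<open>Averages over cells\<close>

text \<open>
  The conditional expectation with respect to the partition into cells of order \<open>P\<close>. The fractional
  part makes it a periodic function on the whole line whose values depend only on one period of \<open>f\<close>.
\<close>

definition cell_mean :: "nat \<Rightarrow> (real \<Rightarrow> real) \<Rightarrow> real \<Rightarrow> real" where
  "cell_mean P f x = real P * (LINT y|circle. (if \<lfloor>real P * y\<rfloor> = \<lfloor>real P * frac x\<rfloor> then f y else 0))"

lemma cell_mean_periodic: "cell_mean P f (x + 1) = cell_mean P f x"
  by (simp add: cell_mean_def frac_def)

lemma cell_mean_measurable [measurable]:
  assumes [measurable]: "f \<in> borel_measurable borel"
  shows "cell_mean P f \<in> borel_measurable borel"
  unfolding cell_mean_def frac_def by measurable

lemma cell_step_cell_mean:
  assumes "P > 0" shows "cell_step P (cell_mean P f)"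
  unfolding cell_step_def
proof (intro allI impI)
  fix x y assume xy: "\<lfloor>real P * x\<rfloor> = \<lfloor>real P * y\<rfloor>"
  then have "\<lfloor>x\<rfloor> = \<lfloor>y\<rfloor>" using floor_mult_div[OF assms, of x] floor_mult_div[OF assms, of y] by simp
  then have "\<lfloor>real P * frac x\<rfloor> = \<lfloor>real P * frac y\<rfloor>" using xy by (simp add: floor_mult_frac)
  then show "cell_mean P f x = cell_mean P f y" by (simp add: cell_mean_def)
qed

lemma integrable_circle_if:
  fixes f :: "real \<Rightarrow> real"
  assumes "integrable circle f" "Measurable.pred borel Q"
  shows "integrable circle (\<lambda>y. if Q y then f y else 0)"
proof (rule Bochner_Integration.integrable_bound[OF assms(1)])
  have [measurable]: "f \<in> borel_measurable circle" using assms(1) by (rule borel_measurable_integrable)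
  have [measurable]: "Measurable.pred circle Q" 
    using measurable_compose[OF measurable_ident_circle assms(2)] by simp
  show "(\<lambda>y. if Q y then f y else 0) \<in> borel_measurable circle" by measurable
qed auto

lemma abs_cell_mean_le:
  assumes "integrable circle f"
  shows "\<bar>cell_mean P f x\<bar> \<le> cell_mean P (\<lambda>y. \<bar>f y\<bar>) x"
proof -
  have "\<bar>LINT y|circle. (if \<lfloor>real P * y\<rfloor> = \<lfloor>real P * frac x\<rfloor> then f y else 0)\<bar>
     \<le> (LINT y|circle. \<bar>if \<lfloor>real P * y\<rfloor> = \<lfloor>real P * frac x\<rfloor> then f y else 0\<bar>)"
    by (rule integral_abs_bound)
  also have "\<dots> = (LINT y|circle. (if \<lfloor>real P * y\<rfloor> = \<lfloor>real P * frac x\<rfloor> then \<bar>f y\<bar> else 0))"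
    by (rule Bochner_Integration.integral_cong) auto
  finally show ?thesis by (simp add: cell_mean_def abs_mult mult_left_mono)
qed

lemma cell_mean_nonneg: "(\<And>y. 0 \<le> f y) \<Longrightarrow> 0 \<le> cell_mean P f x"
  unfolding cell_mean_def by (intro mult_nonneg_nonneg Bochner_Integration.integral_nonneg) auto

lemma cell_mean_bounded:
  assumes "integrable circle f"
  shows "\<bar>cell_mean P f x\<bar> \<le> real P * (LINT y|circle. \<bar>f y\<bar>)"
proof -
  have "cell_mean P (\<lambda>y. \<bar>f y\<bar>) x \<le> real P * (LINT y|circle. \<bar>f y\<bar>)"
    unfolding cell_mean_def
    using assms by (intro mult_left_mono integral_mono integrable_circle_if) auto
  then show ?thesis using abs_cell_mean_le[OF assms, of P x] by linarith
qed

lemma cell_mean_sum: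
  assumes "finite I" "\<And>i. i \<in> I \<Longrightarrow> integrable circle (f i)"
  shows "cell_mean P (\<lambda>y. \<Sum>i\<in>I. a i * f i y) x = (\<Sum>i\<in>I. a i * cell_mean P (f i) x)"
proof -
  have "(LINT y|circle. (if \<lfloor>real P * y\<rfloor> = \<lfloor>real P * frac x\<rfloor> then \<Sum>i\<in>I. a i * f i y else 0))
     = (LINT y|circle. (\<Sum>i\<in>I. a i * (if \<lfloor>real P * y\<rfloor> = \<lfloor>real P * frac x\<rfloor> then f i y else 0)))"
    by (rule Bochner_Integration.integral_cong) auto
  also have "\<dots> = (\<Sum>i\<in>I. LINT y|circle. a i * (if \<lfloor>real P * y\<rfloor> = \<lfloor>real P * frac x\<rfloor> then f i y else 0))"
    using assms by (intro Bochner_Integration.integral_sum integrable_mult_right integrable_circle_if) auto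
  finally show ?thesis
    by (simp add: cell_mean_def sum_distrib_left mult.left_commute)
qed

text \<open>
  The defining property of a conditional expectation. By Fubini, both sides are the integral of
  \<open>P f y \<phi> y\<close> over all pairs \<open>x\<close>, \<open>y\<close> in a common cell, because \<open>\<phi>\<close> does not
  distinguish such points.
\<close>

lemma integral_cell_mean_mult:
  assumes f [measurable]: "f \<in> borel_measurable borel" and \<phi> [measurable]: "\<phi> \<in> borel_measurable borel"
    and int: "integrable circle f" and step: "cell_step P \<phi>" and bd: "\<And>x. \<bar>\<phi> x\<bar> \<le> C" and P: "P > 0"
  shows "(LINT x|circle. cell_mean P f x * \<phi> x) = (LINT x|circle. f x * \<phi> x)"
proof -
  define k where "k x y = (if \<lfloor>real P * y\<rfloor> = \<lfloor>real P * x\<rfloor> then f y * \<phi> y else 0)" for x y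
  have C: "C \<ge> 0" using bd[of 0] by linarith
  have km [measurable]: "(\<lambda>(x, y). k x y) \<in> borel_measurable (circle \<Otimes>\<^sub>M circle)"
    unfolding k_def by measurable
  have fphi: "integrable circle (\<lambda>y. f y * \<phi> y)"
  proof (rule Bochner_Integration.integrable_bound[of circle "\<lambda>y. C * f y"])
    show "AE x in circle. norm (f x * \<phi> x) \<le> norm (C * f x)"
      using bd C by (auto simp: abs_mult intro!: mult_right_mono simp: mult.commute)
  qed (use int in auto)
  have kint: "integrable circle (k x)" for x
    unfolding k_def by (rule integrable_circle_if[OF fphi]) measurable
  have "integrable (circle \<Otimes>\<^sub>M circle) (\<lambda>(x, y). k x y)"
  proof (rule circle2.Fubini_integrable)
    show "integrable circle (\<lambda>x. LINT y|circle. norm (case (x, y) of (x, y) \<Rightarrow> k x y))"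
    proof (rule circle.integrable_const_bound[where B = "LINT y|circle. \<bar>f y * \<phi> y\<bar>"])
      show "AE x in circle. norm (LINT y|circle. norm (case (x, y) of (x, y) \<Rightarrow> k x y)) \<le> (LINT y|circle. \<bar>f y * \<phi> y\<bar>)"
      proof (rule AE_I2)
        fix x
        have "(LINT y|circle. \<bar>k x y\<bar>) \<le> (LINT y|circle. \<bar>f y * \<phi> y\<bar>)"
          using integrable_abs[OF kint[of x]] integrable_abs[OF fphi] by (rule integral_mono) (simp add: k_def)
        then show "norm (LINT y|circle. norm (case (x, y) of (x, y) \<Rightarrow> k x y)) \<le> (LINT y|circle. \<bar>f y * \<phi> y\<bar>)"
          by simp
      qed
    qed measurable
    show "AE x in circle. integrable circle (\<lambda>y. case (x, y) of (x, y) \<Rightarrow> k x y)"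
      using kint by simp
  qed measurable
  then have fub: "(LINT y|circle. (LINT x|circle. k x y)) = (LINT x|circle. (LINT y|circle. k x y))"
    by (rule circle2.Fubini_integral)
  have "(LINT x|circle. cell_mean P f x * \<phi> x) = (LINT x|circle. real P * (LINT y|circle. k x y))"
  proof (rule Bochner_Integration.integral_cong)
    fix x assume "x \<in> space circle"
    then have fr: "frac x = x" by (simp add: frac_eq)
    have "k x y = \<phi> x * (if \<lfloor>real P * y\<rfloor> = \<lfloor>real P * frac x\<rfloor> then f y else 0)" for y
      using cell_stepD[OF step, of x y] by (auto simp: k_def fr)
    then show "cell_mean P f x * \<phi> x = real P * (LINT y|circle. k x y)"
      by (simp add: cell_mean_def mult.commute)
  qed simp
  also have "\<dots> = real P * (LINT y|circle. (LINT x|circle. k x y))" using fub by simp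
  also have "(LINT y|circle. (LINT x|circle. k x y)) = (LINT y|circle. f y * \<phi> y * (1 / real P))"
  proof (rule Bochner_Integration.integral_cong)
    fix y assume "y \<in> space circle"
    then have y: "0 \<le> y" "y < 1" by auto
    have fl: "0 \<le> \<lfloor>real P * y\<rfloor>" "\<lfloor>real P * y\<rfloor> < int P" using y P by (auto simp: floor_less_iff)
    have "k x y = f y * \<phi> y * (if \<lfloor>real P * x\<rfloor> = \<lfloor>real P * y\<rfloor> then 1 else 0)" for x
      by (simp add: k_def)
    then show "(LINT x|circle. k x y) = f y * \<phi> y * (1 / real P)"
      using integral_circle_cell[OF fl] by simp
  qed simp
  finally show ?thesis using P by simp
qed

lemma integral_cell_mean:
  assumes "f \<in> borel_measurable borel" "integrable circle f" "P > 0"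
  shows "(LINT x|circle. cell_mean P f x) = (LINT x|circle. f x)"
  using integral_cell_mean_mult[of f "\<lambda>_. 1" P 1] assms by simp

text \<open>
  Jensen's inequality: the mean over \<open>y\<close> in the cell of \<open>x\<close> of \<open>f x - f y\<close> is
  \<open>f x - cell_mean P f x\<close>.
\<close>

lemma cell_mean_variance:
  assumes [measurable]: "f \<in> borel_measurable borel" and f: "L2le f c" and P: "P > 0" and x: "0 \<le> x" "x < 1"
  shows "ennreal ((f x - cell_mean P f x)\<^sup>2)
    \<le> ennreal (real P) * (\<integral>\<^sup>+y. (if \<lfloor>real P * y\<rfloor> = \<lfloor>real P * x\<rfloor> then ennreal ((f y - f x)\<^sup>2) else 0) \<partial>circle)"
proof -
  define Q where "Q y \<longleftrightarrow> \<lfloor>real P * y\<rfloor> = \<lfloor>real P * x\<rfloor>" for y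
  have [measurable]: "Measurable.pred borel Q" unfolding Q_def by measurable
  define m where "m = f x - cell_mean P f x"
  define e where "e y = (if Q y then 1 else 0 :: real)" for y
  have fr: "frac x = x" using x by (simp add: frac_eq)
  have fl: "0 \<le> \<lfloor>real P * x\<rfloor>" "\<lfloor>real P * x\<rfloor> < int P" using x P by (auto simp: floor_less_iff)
  note i1 = L2le_integrable[OF f] note i2 = L2le_integrable_square[OF f]
  have ie: "integrable circle e" unfolding e_def by (rule integrable_circle_if) auto
  have ief: "integrable circle (\<lambda>y. e y * f y)" 
    using integrable_circle_if[OF i1, of Q] by (simp add: e_def if_distrib[of "\<lambda>t. t * _"] cong: if_cong)
  have ief2: "integrable circle (\<lambda>y. e y * (f y)\<^sup>2)" 
    using integrable_circle_if[OF i2, of Q] by (simp add: e_def if_distrib[of "\<lambda>t. t * _"] cong: if_cong)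
  have Ie: "(LINT y|circle. e y) = 1 / P" using integral_circle_cell[OF fl] by (simp add: e_def Q_def)
  have If: "(LINT y|circle. e y * f y) = cell_mean P f x / P" 
    using P by (simp add: cell_mean_def e_def Q_def fr if_distrib[of "\<lambda>t. t * _"] cong: if_cong)
  have exp: "e y * (f x - f y - m)\<^sup>2 = (e y * (f y - f x)\<^sup>2) - 2 * m * (f x * e y - e y * f y) + m\<^sup>2 * e y" for y
    by (simp add: power2_eq_square algebra_simps)
  have id: "integrable circle (\<lambda>y. e y * (f y - f x)\<^sup>2)"
  proof -
    have "integrable circle (\<lambda>y. e y * (f y)\<^sup>2 - 2 * f x * (e y * f y) + (f x)\<^sup>2 * e y)"
      using ie ief ief2 by simp
    also have "(\<lambda>y. e y * (f y)\<^sup>2 - 2 * f x * (e y * f y) + (f x)\<^sup>2 * e y) = (\<lambda>y. e y * (f y - f x)\<^sup>2)"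
      by (simp add: power2_eq_square algebra_simps)
    finally show ?thesis .
  qed
  \<comment> \<open>Again a variance is nonnegative.\<close>
  have "0 \<le> (LINT y|circle. e y * (f x - f y - m)\<^sup>2)" by (intro Bochner_Integration.integral_nonneg) (simp add: e_def)
  also have "\<dots> = (LINT y|circle. e y * (f y - f x)\<^sup>2) - 2 * m * (f x / P - cell_mean P f x / P) + m\<^sup>2 / P"
    unfolding exp using ie ief id by (simp add: Ie If)
  also have "\<dots> = (LINT y|circle. e y * (f y - f x)\<^sup>2) - m\<^sup>2 / P"
    by (simp add: m_def power2_eq_square diff_divide_distrib add_divide_distrib algebra_simps)
  finally have "m\<^sup>2 \<le> P * (LINT y|circle. e y * (f y - f x)\<^sup>2)" using P by (simp add: field_simps)
  then have "ennreal (m\<^sup>2) \<le> ennreal (real P) * ennreal (LINT y|circle. e y * (f y - f x)\<^sup>2)"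
    by (subst ennreal_mult'[symmetric]) (auto intro: ennreal_leI)
  also have "ennreal (LINT y|circle. e y * (f y - f x)\<^sup>2) = (\<integral>\<^sup>+y. ennreal (e y * (f y - f x)\<^sup>2) \<partial>circle)"
    by (rule nn_integral_eq_integral[OF id, symmetric]) (simp add: e_def)
  also have "\<dots> = (\<integral>\<^sup>+y. (if Q y then ennreal ((f y - f x)\<^sup>2) else 0) \<partial>circle)"
    by (intro nn_integral_cong) (simp add: e_def)
  finally show ?thesis by (simp add: m_def Q_def)
qed

text \<open>
  Two points of one cell differ by some \<open>h\<close> with \<open>\<bar>h\<bar> < 1/P\<close>. Hence the variance bound, integrated
  over \<open>x\<close>, is at most \<open>P\<close> times the integral over these \<open>h\<close> of the squared norm of
  \<open>f (x + h) - f x\<close>. The range of \<open>h\<close> has length \<open>2/P\<close>, which produces the factor 2; negative \<open>h\<close> reduce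
  to positive ones by translation invariance.
\<close>

lemma L2le_diff_cell_mean:
  assumes m [measurable]: "f \<in> borel_measurable borel" and per: "\<And>x. f (x + 1) = f x" and f: "L2le f c" and P: "P > 0"
    and \<omega>: "\<And>h. 0 \<le> h \<Longrightarrow> h \<le> 1 / real P \<Longrightarrow> L2le (\<lambda>x. f (x + h) - f x) w"
  shows "L2le (\<lambda>x. f x - cell_mean P f x) (sqrt 2 * w)"
proof -
  interpret CL: pair_sigma_finite circle lborel ..
  have w: "w \<ge> 0" using \<omega>[of 0] by (auto simp: L2le_def)
  define d where "d x h = ennreal ((f (x + h) - f x)\<^sup>2)" for x h
  have [measurable]: "case_prod d \<in> borel_measurable (borel \<Otimes>\<^sub>M borel)" unfolding d_def by measurable
  define A where "A = {- (1 / real P)<..<1 / real P}"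
  have [measurable]: "A \<in> sets borel" by (simp add: A_def)
  have shift: "(\<integral>\<^sup>+x. d x h \<partial>circle) \<le> ennreal (w\<^sup>2)" if "h \<in> A" for h
  proof (cases "h \<ge> 0")
    case True
    then show ?thesis using \<omega>[of h] that by (auto simp: L2le_def d_def A_def)
  next
    case False
    have "(\<integral>\<^sup>+x. d (x + h) (- h) \<partial>circle) = (\<integral>\<^sup>+x. d x (- h) \<partial>circle)"
    proof (rule nn_integral_circle_shift)
      show "d (x + 1) (- h) = d x (- h)" for x using per[of x] per[of "x - h"] by (simp add: d_def algebra_simps)
      have "1 / real P \<le> 1" using P by simp
      then show "\<bar>h\<bar> \<le> 1" using that False by (auto simp: A_def)
    qed measurable
    moreover have "d (x + h) (- h) = d x h" for x by (simp add: d_def power2_commute)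
    ultimately show ?thesis using \<omega>[of "- h"] that False by (auto simp: L2le_def d_def A_def)
  qed
  have "(\<integral>\<^sup>+x. ennreal ((f x - cell_mean P f x)\<^sup>2) \<partial>circle)
    \<le> (\<integral>\<^sup>+x. ennreal (real P) * (\<integral>\<^sup>+h. d x h * indicator A h \<partial>lborel) \<partial>circle)"
  proof (rule nn_integral_mono)
    fix x assume "x \<in> space circle"
    then have x: "0 \<le> x" "x < 1" by auto
    define G where "G y = (if \<lfloor>real P * y\<rfloor> = \<lfloor>real P * x\<rfloor> then ennreal ((f y - f x)\<^sup>2) else 0) * indicator {0..<1} y" for y
    have [measurable]: "G \<in> borel_measurable borel" unfolding G_def by measurable
    have "ennreal ((f x - cell_mean P f x)\<^sup>2) \<le> ennreal (real P) * (\<integral>\<^sup>+y. G y \<partial>lborel)"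
      using cell_mean_variance[OF m f P x] by (simp add: nn_integral_circle G_def)
    also have "(\<integral>\<^sup>+y. G y \<partial>lborel) = (\<integral>\<^sup>+h. G (h + x) \<partial>lborel)"
      by (rule nn_integral_lborel_shift[symmetric]) measurable
    also have "\<dots> \<le> (\<integral>\<^sup>+h. d x h * indicator A h \<partial>lborel)"
    proof (rule nn_integral_mono)
      fix h
      show "G (h + x) \<le> d x h * indicator A h"
      proof (cases "\<lfloor>real P * (h + x)\<rfloor> = \<lfloor>real P * x\<rfloor>")
        case True
        then have "\<bar>real P * (h + x) - real P * x\<bar> < 1" by linarith
        then have "\<bar>real P * h\<bar> < 1" by (simp add: algebra_simps)
        then have "h \<in> A" using P by (auto simp: A_def field_simps abs_less_iff)
        then show ?thesis by (auto simp: G_def d_def indicator_def add.commute)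
      qed (simp add: G_def)
    qed
    finally show "ennreal ((f x - cell_mean P f x)\<^sup>2) \<le> ennreal (real P) * (\<integral>\<^sup>+h. d x h * indicator A h \<partial>lborel)"
      by (simp add: mult_left_mono)
  qed
  also have "\<dots> = ennreal (real P) * (\<integral>\<^sup>+x. (\<integral>\<^sup>+h. d x h * indicator A h \<partial>lborel) \<partial>circle)"
    by (rule nn_integral_cmult) measurable
  also have "(\<integral>\<^sup>+x. (\<integral>\<^sup>+h. d x h * indicator A h \<partial>lborel) \<partial>circle) = (\<integral>\<^sup>+h. (\<integral>\<^sup>+x. d x h * indicator A h \<partial>circle) \<partial>lborel)"
    by (rule CL.Fubini'[symmetric]) measurable
  also have "\<dots> \<le> (\<integral>\<^sup>+h. ennreal (w\<^sup>2) * indicator A h \<partial>lborel)"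
    using shift by (intro nn_integral_mono) (auto simp: indicator_def)
  also have "\<dots> = ennreal (w\<^sup>2) * ennreal (2 / real P)"
    using P by (simp add: nn_integral_cmult_indicator A_def)
  finally have "(\<integral>\<^sup>+x. ennreal ((f x - cell_mean P f x)\<^sup>2) \<partial>circle) \<le> ennreal (real P) * (ennreal (w\<^sup>2) * ennreal (2 / real P))"
    by (simp add: mult_left_mono)
  also have "\<dots> = ennreal (real P * (w\<^sup>2 * (2 / real P)))"
    by (simp only: ennreal_mult' of_nat_0_le_iff zero_le_power2)
  also have "real P * (w\<^sup>2 * (2 / real P)) = (sqrt 2 * w)\<^sup>2" using P by (simp add: power_mult_distrib)
  finally show ?thesis using w by (simp add: L2le_def)
qed

section \<open>Step functions at separated scales\<close>

text \<open>
  A step function differs from its translate by \<open>h\<close> only at points at most \<open>h\<close> to the left of a cell boundary, a set of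
  relative measure \<open>h P\<close> in every cell. Membership in that set is a function of \<open>P x\<close> modulo 1, so
  it is independent of the step function.
\<close>

lemma L2le_step_shift:
  assumes [measurable]: "g \<in> borel_measurable borel" and per: "\<And>x. g (x + 1) = g x"
    and step: "cell_step P g" and P: "P > 0" and h: "0 \<le> h" "h \<le> 1 / real P" and g: "L2le g c"
  shows "L2le (\<lambda>x. g (x + h) - g x) (sqrt (4 * h * real P) * c)"
proof -
  define t where "t = real P * h"
  have t: "0 \<le> t" "t \<le> 1" using h P by (auto simp: t_def field_simps)
  have "1 / real P \<le> 1" using P by simp
  then have h1: "\<bar>h\<bar> \<le> 1" using h by linarith
  have c: "c \<ge> 0" using g by (rule L2le_nonneg)
  define \<phi> where "\<phi> x = ennreal ((g x)\<^sup>2)" for x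
  \<comment> \<open>\<open>\<psi>1 (P x)\<close> marks the points that cross a boundary when moved by \<open>h\<close>, and \<open>\<psi>2 (P y)\<close> the points reached in this way.\<close>
  define \<psi>1 \<psi>2 where "\<psi>1 y = (if 1 - t \<le> frac y then 1 else 0 :: ennreal)" and "\<psi>2 y = (if frac y < t then 1 else 0 :: ennreal)" for y :: real
  have [measurable]: "\<phi> \<in> borel_measurable borel" unfolding \<phi>_def by measurable
  have [measurable]: "\<psi>1 \<in> borel_measurable borel" unfolding \<psi>1_def by measurable
  have [measurable]: "\<psi>2 \<in> borel_measurable borel" unfolding \<psi>2_def by measurable
  have step': "cell_step P \<phi>" unfolding \<phi>_def using step by (rule cell_step_compose)
  have per': "\<psi>1 (x + 1) = \<psi>1 x" "\<psi>2 (x + 1) = \<psi>2 x" "\<phi> (x + 1) = \<phi> x" for x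
    by (simp_all add: \<psi>1_def \<psi>2_def \<phi>_def frac_def per)
  have I1: "(\<integral>\<^sup>+y. \<psi>1 y \<partial>circle) = ennreal t"
  proof -
    have "(\<integral>\<^sup>+y. \<psi>1 y \<partial>circle) = (\<integral>\<^sup>+y. indicator {1 - t..<1} y \<partial>lborel)"
      unfolding nn_integral_circle using t
      by (intro nn_integral_cong) (auto simp: \<psi>1_def indicator_def frac_eq)
    then show ?thesis using t by simp
  qed
  have I2: "(\<integral>\<^sup>+y. \<psi>2 y \<partial>circle) = ennreal t"
  proof -
    have "(\<integral>\<^sup>+y. \<psi>2 y \<partial>circle) = (\<integral>\<^sup>+y. indicator {0..<t} y \<partial>lborel)"
      unfolding nn_integral_circle using t
      by (intro nn_integral_cong) (auto simp: \<psi>2_def indicator_def frac_eq)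
    then show ?thesis using t by simp
  qed
  have pt: "ennreal ((g (x + h) - g x)\<^sup>2) \<le> 2 * (\<phi> x * \<psi>1 (real P * x)) + 2 * (\<phi> (x + h) * \<psi>2 (real P * (x + h)))" for x
  proof (cases "frac (real P * x) < 1 - t")
    case True
    have e: "real P * (x + h) = of_int \<lfloor>real P * x\<rfloor> + (frac (real P * x) + t)"
      by (simp add: t_def frac_def algebra_simps)
    have "frac (real P * x) \<ge> 0" by simp
    then have "\<lfloor>real P * (x + h)\<rfloor> = \<lfloor>real P * x\<rfloor>" using True t unfolding e by linarith
    then have "g (x + h) = g x" using cell_stepD[OF step] by blast
    then show ?thesis by simp
  next
    case False
    have e: "real P * (x + h) = of_int (\<lfloor>real P * x\<rfloor> + 1) + (frac (real P * x) + t - 1)"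
      by (simp add: t_def frac_def algebra_simps)
    have fr: "frac (real P * x) < 1" by (rule frac_lt_1)
    then have "\<lfloor>real P * (x + h)\<rfloor> = \<lfloor>real P * x\<rfloor> + 1" using False t unfolding e by linarith
    then have "frac (real P * (x + h)) < t" using fr e by (simp add: frac_def)
    then have "\<psi>2 (real P * (x + h)) = 1" "\<psi>1 (real P * x) = 1" using False by (auto simp: \<psi>1_def \<psi>2_def)
    moreover have "(g (x + h) - g x)\<^sup>2 \<le> 2 * (g x)\<^sup>2 + 2 * (g (x + h))\<^sup>2"
      using weighted_square_add[of 1 1 "g (x + h)" "- g x"] by simp
    then have "ennreal ((g (x + h) - g x)\<^sup>2) \<le> ennreal (2 * (g x)\<^sup>2 + 2 * (g (x + h))\<^sup>2)" by (rule ennreal_leI)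
    then have "ennreal ((g (x + h) - g x)\<^sup>2) \<le> 2 * \<phi> x + 2 * \<phi> (x + h)"
      by (simp add: \<phi>_def ennreal_plus ennreal_mult)
    ultimately show ?thesis by simp
  qed
  have s: "(\<integral>\<^sup>+x. \<phi> (x + h) * \<psi>2 (real P * (x + h)) \<partial>circle) = (\<integral>\<^sup>+x. \<phi> x * \<psi>2 (real P * x) \<partial>circle)"
    using h1 nn_integral_circle_shift[of "\<lambda>x. \<phi> x * \<psi>2 (real P * x)" h] 
    by (simp add: per' periodic_mult_nat[of \<psi>2, OF per'(2)])
  have "(\<integral>\<^sup>+x. ennreal ((g (x + h) - g x)\<^sup>2) \<partial>circle)
    \<le> (\<integral>\<^sup>+x. 2 * (\<phi> x * \<psi>1 (real P * x)) + 2 * (\<phi> (x + h) * \<psi>2 (real P * (x + h))) \<partial>circle)"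
    by (intro nn_integral_mono pt)
  also have "\<dots> = 2 * (\<integral>\<^sup>+x. \<phi> x * \<psi>1 (real P * x) \<partial>circle) + 2 * (\<integral>\<^sup>+x. \<phi> x * \<psi>2 (real P * x) \<partial>circle)"
    by (simp add: nn_integral_add nn_integral_cmult s)
  also have "\<dots> = 2 * ((\<integral>\<^sup>+x. \<phi> x \<partial>circle) * ennreal t) + 2 * ((\<integral>\<^sup>+x. \<phi> x \<partial>circle) * ennreal t)"
    using nn_integral_circle_step_dilation[of \<phi> \<psi>1 P] nn_integral_circle_step_dilation[of \<phi> \<psi>2 P] step' P per'
    by (simp add: I1 I2)
  also have "\<dots> \<le> 2 * (ennreal (c\<^sup>2) * ennreal t) + 2 * (ennreal (c\<^sup>2) * ennreal t)"
    using g by (intro add_mono mult_left_mono mult_right_mono) (auto simp: L2le_def \<phi>_def)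
  also have "\<dots> = ennreal (2 * (c\<^sup>2 * t) + 2 * (c\<^sup>2 * t))"
    using t by (simp only: ennreal_plus ennreal_mult' zero_le_power2 mult_nonneg_nonneg ennreal_numeral zero_le_numeral)
  also have "2 * (c\<^sup>2 * t) + 2 * (c\<^sup>2 * t) = (sqrt (4 * h * real P) * c)\<^sup>2"
    using h by (simp add: power_mult_distrib t_def algebra_simps)
  finally show ?thesis using h c by (simp add: L2le_def)
qed

text \<open>
  The interval \<open>[0, s)\<close> consists of full cells of order \<open>N\<close>, on each of which the dilated function has
  integral zero, and of a part of one more cell.
\<close>

lemma abs_integral_dilation_initial:
  assumes [measurable]: "g \<in> borel_measurable borel" and per: "\<And>x. g (x + 1) = g x"
    and int: "integrable circle g" and mean: "(LINT x|circle. g x) = 0" and N: "N > 0" and s: "0 \<le> s" "s \<le> 1"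
  shows "\<bar>LINT x|circle. (if x < s then g (real N * x) else 0)\<bar> \<le> (LINT x|circle. \<bar>g x\<bar>) / N"
proof -
  define k where "k = \<lfloor>real N * s\<rfloor>"
  have "real N * s \<le> real N" using s by (simp add: mult_left_le)
  then have k: "0 \<le> k" "k \<le> int N" using floor_mono[of "real N * s" "real N"] s by (auto simp: k_def)
  define \<phi>1 \<phi>2 where "\<phi>1 x = (if \<lfloor>real N * x\<rfloor> < k then 1 else 0 :: real)" and "\<phi>2 x = (if \<lfloor>real N * x\<rfloor> = k then 1 else 0 :: real)" for x
  have [measurable]: "\<phi>1 \<in> borel_measurable borel" "\<phi>2 \<in> borel_measurable borel" unfolding \<phi>1_def \<phi>2_def by measurable
  have step: "cell_step N \<phi>1" "cell_step N \<phi>2" unfolding \<phi>1_def \<phi>2_def by (rule cell_step_floor)+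
  have iphi: "integrable circle \<phi>1" "integrable circle \<phi>2" 
    by (rule integrable_circle_bounded[where C = 1]; auto simp: \<phi>1_def \<phi>2_def)+
  have m: "\<phi>1 \<in> borel_measurable borel" "\<phi>2 \<in> borel_measurable borel" "(\<lambda>x. \<bar>g x\<bar>) \<in> borel_measurable borel" by measurable
  have pos: "\<phi>1 x \<ge> 0" "\<phi>2 x \<ge> 0" for x by (auto simp: \<phi>1_def \<phi>2_def)
  note d1i = integral_circle_step_dilation(1)[OF m(1) assms(1) per step(1) N pos(1) iphi(1) int]
  have d1e: "(LINT x|circle. \<phi>1 x * g (real N * x)) = 0"
    using integral_circle_step_dilation(2)[OF m(1) assms(1) per step(1) N pos(1) iphi(1) int] mean by simp
  have per': "\<bar>g (x + 1)\<bar> = \<bar>g x\<bar>" for x by (simp add: per)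
  note d2i = integral_circle_step_dilation(1)[OF m(2) m(3) per' step(2) N pos(2) iphi(2) integrable_abs[OF int]]
  note d2e = integral_circle_step_dilation(2)[OF m(2) m(3) per' step(2) N pos(2) iphi(2) integrable_abs[OF int]]
  have I2: "(LINT x|circle. \<phi>2 x) \<le> 1 / N"
  proof (cases "k < int N")
    case True
    then show ?thesis using integral_circle_cell[OF k(1) True] by (simp add: \<phi>2_def)
  next
    case False
    have "(LINT x|circle. \<phi>2 x) = (LINT x|circle. 0)"
    proof (rule Bochner_Integration.integral_cong)
      fix x assume "x \<in> space circle"
      then have "\<lfloor>real N * x\<rfloor> < int N" using N by (auto simp: floor_less_iff)
      then show "\<phi>2 x = 0" using False by (auto simp: \<phi>2_def)
    qed simp
    then show ?thesis by simp
  qed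
  define r where "r x = (if x < s then g (real N * x) else 0) - \<phi>1 x * g (real N * x)" for x
  have r_bd: "\<bar>r x\<bar> \<le> \<phi>2 x * \<bar>g (real N * x)\<bar>" for x
  proof -
    have fl: "x < s \<Longrightarrow> \<lfloor>real N * x\<rfloor> \<le> k" unfolding k_def using N by (intro floor_mono) simp
    have fl2: "\<lfloor>real N * x\<rfloor> < k \<Longrightarrow> x < s"
    proof -
      assume "\<lfloor>real N * x\<rfloor> < k"
      then have "real N * x < of_int k" by (simp add: floor_less_iff)
      also have "of_int k \<le> real N * s" by (simp add: k_def)
      finally show "x < s" using N by simp
    qed
    show ?thesis using fl fl2 by (auto simp: r_def \<phi>1_def \<phi>2_def)
  qed
  have [measurable]: "r \<in> borel_measurable borel" unfolding r_def by measurable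
  have ri: "integrable circle r"
  proof (rule Bochner_Integration.integrable_bound[OF d2i])
    show "AE x in circle. norm (r x) \<le> norm (\<phi>2 x * \<bar>g (real N * x)\<bar>)"
      using order_trans[OF r_bd abs_ge_self] by simp
  qed measurable
  have "(LINT x|circle. (if x < s then g (real N * x) else 0)) = (LINT x|circle. r x + \<phi>1 x * g (real N * x))"
    by (simp add: r_def)
  also have "\<dots> = (LINT x|circle. r x)" using ri d1i d1e by simp
  finally have "\<bar>LINT x|circle. (if x < s then g (real N * x) else 0)\<bar> = \<bar>LINT x|circle. r x\<bar>" by simp
  also have "\<dots> \<le> (LINT x|circle. \<bar>r x\<bar>)" by (rule integral_abs_bound)
  also have "\<dots> \<le> (LINT x|circle. \<phi>2 x * \<bar>g (real N * x)\<bar>)"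
    using ri d2i r_bd by (intro integral_mono integrable_abs) auto
  also have "\<dots> \<le> 1 / N * (LINT x|circle. \<bar>g x\<bar>)"
    unfolding d2e by (intro mult_right_mono I2) simp
  finally show ?thesis by simp
qed

lemma integrable_circle_dilation:
  fixes g :: "real \<Rightarrow> real"
  assumes "g \<in> borel_measurable borel" "\<And>x. g (x + 1) = g x" "integrable circle g" "N > 0"
  shows "integrable circle (\<lambda>x. g (real N * x))" and "(LINT x|circle. g (real N * x)) = (LINT x|circle. g x)"
proof -
  have pos: "(0::real) \<le> 1" by simp
  have i: "integrable circle (\<lambda>_. 1 :: real)" by simp
  note d = integral_circle_step_dilation[OF borel_measurable_const assms(1,2) cell_step_const assms(4) pos i assms(3)]
  show "integrable circle (\<lambda>x. g (real N * x))" using d(1) by simp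
  show "(LINT x|circle. g (real N * x)) = (LINT x|circle. g x)" using d(2) by simp
qed

lemma L2le_dilation:
  assumes "L2le u c" "\<And>x. u (x + 1) = u x" "N > 0"
  shows "L2le (\<lambda>x. u (real N * x)) c"
  using assms nn_integral_circle_dilation[of "\<lambda>x. ennreal ((u x)\<^sup>2)" N] by (auto simp: L2le_def)

text \<open>
  Averages over cells much longer than \<open>1/N\<close> nearly annihilate the dilation by \<open>N\<close>: a cell is the
  difference of two initial intervals.
\<close>

lemma abs_cell_mean_dilation:
  assumes m [measurable]: "g \<in> borel_measurable borel" and per: "\<And>x. g (x + 1) = g x"
    and int: "integrable circle g" and mean: "(LINT x|circle. g x) = 0" and N: "N > 0" and Q: "Q > 0"
  shows "\<bar>cell_mean Q (\<lambda>y. g (real N * y)) x\<bar> \<le> 2 * real Q / real N * (LINT x|circle. \<bar>g x\<bar>)"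
proof -
  define k where "k = \<lfloor>real Q * frac x\<rfloor>"
  have k: "0 \<le> k" "k < int Q" using Q frac_lt_1[of x] by (auto simp: k_def floor_less_iff)
  define a b where "a = of_int k / real Q" and "b = (of_int k + 1) / real Q"
  have kr: "real_of_int k \<ge> 0" "real_of_int k + 1 \<le> real Q" using k by linarith+
  have ab: "0 \<le> a" "a \<le> b" "b \<le> 1" using kr Q by (auto simp: a_def b_def field_simps)
  define J where "J s = (LINT y|circle. (if y < s then g (real N * y) else 0))" for s
  have gi: "integrable circle (\<lambda>y. g (real N * y))" using integrable_circle_dilation[OF m per int N] by simp
  have Ji: "integrable circle (\<lambda>y. (if y < s then g (real N * y) else 0))" for s
    using gi by (rule integrable_circle_if) measurable
  have iff: "\<lfloor>real Q * y\<rfloor> = k \<longleftrightarrow> a \<le> y \<and> y < b" for y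
    using Q by (auto simp: a_def b_def floor_eq_iff field_simps)
  have "(LINT y|circle. (if \<lfloor>real Q * y\<rfloor> = k then g (real N * y) else 0))
    = (LINT y|circle. (if y < b then g (real N * y) else 0) - (if y < a then g (real N * y) else 0))"
    using ab by (intro Bochner_Integration.integral_cong) (auto simp: iff)
  also have "\<dots> = J b - J a" unfolding J_def using Ji by simp
  finally have "\<bar>cell_mean Q (\<lambda>y. g (real N * y)) x\<bar> = real Q * \<bar>J b - J a\<bar>"
    by (simp add: cell_mean_def k_def abs_mult)
  also have "\<dots> \<le> real Q * (2 * ((LINT x|circle. \<bar>g x\<bar>) / N))"
  proof (rule mult_left_mono)
    have "\<bar>J a\<bar> \<le> (LINT x|circle. \<bar>g x\<bar>) / N" "\<bar>J b\<bar> \<le> (LINT x|circle. \<bar>g x\<bar>) / N"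
      unfolding J_def using ab by (auto intro!: abs_integral_dilation_initial[OF m per int mean N])
    then show "\<bar>J b - J a\<bar> \<le> 2 * ((LINT x|circle. \<bar>g x\<bar>) / N)" by linarith
  qed simp
  finally show ?thesis by (simp add: mult_ac)
qed

text \<open>
  Quasi-orthogonality. The dilation by \<open>N\<close> is a step function of order \<open>P N\<close>, so the dilation by \<open>N'\<close>
  may be replaced by its average over the cells of that order, which is small for \<open>N'\<close> large compared to \<open>P N\<close>.
\<close>

lemma abs_integral_mult_dilations:
  assumes m [measurable]: "g \<in> borel_measurable borel" and per: "\<And>x. g (x + 1) = g x"
    and step: "cell_step P g" and bd: "\<And>x. \<bar>g x\<bar> \<le> C" and mean: "(LINT x|circle. g x) = 0"
    and P: "P > 0" and N: "N > 0" "N' > 0"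
  shows "\<bar>LINT x|circle. g (real N * x) * g (real N' * x)\<bar> \<le> 2 * real (P * N) / real N' * (LINT x|circle. \<bar>g x\<bar>)\<^sup>2"
proof -
  define I where "I = (LINT x|circle. \<bar>g x\<bar>)"
  have int: "integrable circle g" using m bd by (rule integrable_circle_bounded)
  have PN: "P * N > 0" using P N by simp
  define B where "B = 2 * real (P * N) / real N' * I"
  have iN: "integrable circle (\<lambda>x. \<bar>g (real N * x)\<bar>)" and eN: "(LINT x|circle. \<bar>g (real N * x)\<bar>) = I"
    using integrable_circle_dilation[of "\<lambda>x. \<bar>g x\<bar>" N] int N per by (auto simp: I_def)
  have "(LINT x|circle. g (real N * x) * g (real N' * x)) = (LINT x|circle. g (real N' * x) * g (real N * x))"
    by (simp add: mult.commute)
  also have "\<dots> = (LINT x|circle. cell_mean (P * N) (\<lambda>y. g (real N' * y)) x * g (real N * x))"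
    using integrable_circle_dilation[OF m per int N(2)] bd PN cell_step_dilation[OF step, of N]
    by (intro integral_cell_mean_mult[symmetric]) auto
  finally have "\<bar>LINT x|circle. g (real N * x) * g (real N' * x)\<bar>
      = \<bar>LINT x|circle. cell_mean (P * N) (\<lambda>y. g (real N' * y)) x * g (real N * x)\<bar>" by simp
  also have "\<dots> \<le> (LINT x|circle. \<bar>cell_mean (P * N) (\<lambda>y. g (real N' * y)) x * g (real N * x)\<bar>)"
    by (rule integral_abs_bound)
  also have "\<dots> \<le> (LINT x|circle. B * \<bar>g (real N * x)\<bar>)"
  proof (rule integral_mono')
    show "integrable circle (\<lambda>x. B * \<bar>g (real N * x)\<bar>)" using iN by simp
    show "\<bar>cell_mean (P * N) (\<lambda>y. g (real N' * y)) x * g (real N * x)\<bar> \<le> B * \<bar>g (real N * x)\<bar>" for x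
      unfolding abs_mult B_def I_def
      by (intro mult_right_mono abs_cell_mean_dilation[OF m per int mean N(2) PN]) simp
  qed (simp add: B_def I_def)
  also have "\<dots> = B * I" by (simp add: eN)
  finally show ?thesis by (simp add: B_def I_def power2_eq_square)
qed

section \<open>The maximal inequality for averages over nested cells\<close>

primrec running_max :: "(nat \<Rightarrow> real \<Rightarrow> real) \<Rightarrow> nat \<Rightarrow> real \<Rightarrow> real" where
  "running_max X 0 = X 0"
| "running_max X (Suc k) = (\<lambda>x. max (running_max X k x) (X (Suc k) x))"

lemma running_max_ge: "j \<le> k \<Longrightarrow> X j x \<le> running_max X k x"
  by (induction k) (auto simp: le_Suc_eq)

lemma running_max_measurable [measurable]:
  assumes [measurable]: "\<And>k. X k \<in> borel_measurable borel"
  shows "running_max X k \<in> borel_measurable borel"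
  by (induction k) simp_all

lemma running_max_bounded: "(\<And>k. \<bar>X k x\<bar> \<le> C k) \<Longrightarrow> \<bar>running_max X k x\<bar> \<le> (\<Sum>j\<le>k. C j)"
proof (induction k)
  case (Suc k)
  have "0 \<le> (\<Sum>j\<le>k. C j)" using Suc.IH[OF Suc.prems] by linarith
  moreover have "0 \<le> C (Suc k)" using Suc.prems[of "Suc k"] by linarith
  ultimately show ?case using Suc.IH[OF Suc.prems] Suc.prems[of "Suc k"] by (auto simp: max_def)
qed simp

text \<open>
  Doob's \<open>L\<^sup>2\<close> inequality. When the running maximum \<open>m\<close> increases, its new value is the current average \<open>X\<close>,
  so the increment of \<open>m\<^sup>2\<close> is at most \<open>2 X\<close> times the increment of \<open>m\<close>. That increment is a step function on
  the current cells, hence the integral does not change if \<open>X\<close> is replaced by \<open>\<bar>F\<bar>\<close>. The sum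
  telescopes to \<open>\<integral>m\<^sup>2 \<le> 2 \<integral>\<bar>F\<bar> m\<close>. Since \<open>2 \<bar>F\<bar> m \<le> 2 F\<^sup>2 + m\<^sup>2/2\<close> and \<open>m\<close> is
  bounded, half of \<open>\<integral>m\<^sup>2\<close> can be absorbed into the left-hand side.
\<close>

lemma Doob_cell_mean:
  fixes F :: "real \<Rightarrow> real" and Q :: "nat \<Rightarrow> nat"
  assumes F [measurable]: "F \<in> borel_measurable borel" and bd: "\<And>x. \<bar>F x\<bar> \<le> C"
    and Q: "\<And>k. Q k > 0" "\<And>k. Q k dvd Q (Suc k)" and c: "L2le F c"
  shows "L2le (running_max (\<lambda>k. cell_mean (Q k) (\<lambda>x. \<bar>F x\<bar>)) n) (2 * c)"
proof -
  define f where "f x = \<bar>F x\<bar>" for x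
  define X where "X k = cell_mean (Q k) f" for k
  define m where "m = running_max X"
  have f [measurable]: "f \<in> borel_measurable borel" unfolding f_def by measurable
  have X [measurable]: "X k \<in> borel_measurable borel" for k unfolding X_def by measurable
  have mm [measurable]: "m k \<in> borel_measurable borel" for k unfolding m_def by measurable
  have fbd: "\<bar>f x\<bar> \<le> C" for x using bd by (simp add: f_def)
  have fi: "integrable circle f" using f fbd by (rule integrable_circle_bounded)
  have Xbd: "\<bar>X k x\<bar> \<le> Q k * (LINT y|circle. \<bar>f y\<bar>)" for k x 
    unfolding X_def by (rule cell_mean_bounded[OF fi])
  define D where "D k = (\<Sum>j\<le>k. Q j * (LINT y|circle. \<bar>f y\<bar>))" for k
  have mbd: "\<bar>m k x\<bar> \<le> D k" for k x unfolding m_def D_def by (rule running_max_bounded) (rule Xbd)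
  have Xnn: "X k x \<ge> 0" for k x unfolding X_def by (rule cell_mean_nonneg) (simp add: f_def)
  have mnn: "m k x \<ge> 0" for k x using running_max_ge[of 0 k X x] Xnn[of 0 x] by (simp add: m_def)
  have mstep: "cell_step (Q k) (m k)" for k
  proof (induction k)
    case 0
    then show ?case using cell_step_cell_mean[OF Q(1)] by (simp add: m_def X_def)
  next
    case (Suc k)
    have "cell_step (Q (Suc k)) (m k)" using Suc Q by (blast intro: cell_step_dvd)
    moreover have "cell_step (Q (Suc k)) (X (Suc k))" using cell_step_cell_mean[OF Q(1)] by (simp add: X_def)
    ultimately show ?case unfolding m_def running_max.simps by (rule cell_step_compose2)
  qed
  have prodi: "integrable circle (\<lambda>x. u x * v x)"
    if [measurable]: "u \<in> borel_measurable borel" "v \<in> borel_measurable borel" and "\<And>x. \<bar>u x\<bar> \<le> A" "\<And>x. \<bar>v x\<bar> \<le> B" for u v :: "real \<Rightarrow> real" and A B :: real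
  proof (rule integrable_circle_bounded[where C = "A * B"])
    show "\<bar>u x * v x\<bar> \<le> A * B" for x
      unfolding abs_mult using that(3)[of x] that(4)[of x] by (intro mult_mono) auto
  qed measurable
  have m2i: "integrable circle (\<lambda>x. (m k x)\<^sup>2)" for k
    unfolding power2_eq_square by (rule prodi[OF mm mm mbd mbd])
  have fmi: "integrable circle (\<lambda>x. f x * m k x)" for k
    by (rule prodi[OF f mm fbd mbd])
  have main: "(LINT x|circle. (m k x)\<^sup>2) \<le> 2 * (LINT x|circle. f x * m k x)" for k
  proof (induction k)
    case 0
    have "(LINT x|circle. (m 0 x)\<^sup>2) = (LINT x|circle. X 0 x * m 0 x)"
      by (simp add: m_def power2_eq_square)
    also have "\<dots> = (LINT x|circle. f x * m 0 x)"
      unfolding X_def by (rule integral_cell_mean_mult[OF f mm fi mstep mbd Q(1)])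
    moreover have "0 \<le> (LINT x|circle. f x * m 0 x)"
      using mnn by (intro Bochner_Integration.integral_nonneg) (simp add: f_def)
    ultimately show ?case by simp
  next
    case (Suc k)
    let ?d = "\<lambda>x. m (Suc k) x - m k x"
    have dbd: "\<bar>m (Suc k) x - m k x\<bar> \<le> D (Suc k) + D k" for x using mbd[of "Suc k" x] mbd[of k x] by linarith
    have dstep: "cell_step (Q (Suc k)) ?d"
      by (rule cell_step_compose2[OF mstep cell_step_dvd[OF mstep Q(2) Q(1)]])
    have Xdi: "integrable circle (\<lambda>x. X (Suc k) x * ?d x)"
      by (rule prodi[OF X _ Xbd dbd]) measurable
    have "(LINT x|circle. (m (Suc k) x)\<^sup>2) \<le> (LINT x|circle. (m k x)\<^sup>2 + 2 * (X (Suc k) x * ?d x))"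
    proof (rule integral_mono)
      show "integrable circle (\<lambda>x. (m (Suc k) x)\<^sup>2)" by (rule m2i)
      show "integrable circle (\<lambda>x. (m k x)\<^sup>2 + 2 * (X (Suc k) x * ?d x))" using m2i Xdi by simp
      fix x
      have "m (Suc k) x = max (m k x) (X (Suc k) x)" by (simp add: m_def)
      then have "m (Suc k) x = m k x \<or> (m (Suc k) x = X (Suc k) x \<and> m k x \<le> X (Suc k) x)" by (auto simp: max_def)
      then show "(m (Suc k) x)\<^sup>2 \<le> (m k x)\<^sup>2 + 2 * (X (Suc k) x * ?d x)"
      proof
        assume a: "m (Suc k) x = X (Suc k) x \<and> m k x \<le> X (Suc k) x"
        have "0 \<le> (X (Suc k) x - m k x)\<^sup>2" by simp
        then show ?thesis using a by (simp add: power2_eq_square algebra_simps)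
      qed simp
    qed
    also have "\<dots> = (LINT x|circle. (m k x)\<^sup>2) + 2 * (LINT x|circle. X (Suc k) x * ?d x)"
      using m2i Xdi by simp
    also have "(LINT x|circle. X (Suc k) x * ?d x) = (LINT x|circle. f x * ?d x)"
      unfolding X_def by (rule integral_cell_mean_mult[OF f _ fi dstep dbd Q(1)]) measurable
    also have "\<dots> = (LINT x|circle. f x * m (Suc k) x) - (LINT x|circle. f x * m k x)"
      using fmi by (simp add: right_diff_distrib)
    finally show ?case using Suc.IH by simp
  qed
  have f2i: "integrable circle (\<lambda>x. (f x)\<^sup>2)" and f2: "(LINT x|circle. (f x)\<^sup>2) \<le> c\<^sup>2"
    using L2le_integrable_square[OF c] L2le_integral_square[OF c] by (simp_all add: f_def)
  have "2 * (LINT x|circle. f x * m n x) = (LINT x|circle. 2 * (f x * m n x))" by simp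
  also have "\<dots> \<le> (LINT x|circle. 2 * (f x)\<^sup>2 + (m n x)\<^sup>2 / 2)"
  proof (rule integral_mono)
    show "integrable circle (\<lambda>x. 2 * (f x * m n x))" using fmi by simp
    show "integrable circle (\<lambda>x. 2 * (f x)\<^sup>2 + (m n x)\<^sup>2 / 2)" using f2i m2i by simp
    show "2 * (f x * m n x) \<le> 2 * (f x)\<^sup>2 + (m n x)\<^sup>2 / 2" for x
      using zero_le_power2[of "2 * f x - m n x"] by (simp add: power2_eq_square algebra_simps)
  qed
  also have "\<dots> = 2 * (LINT x|circle. (f x)\<^sup>2) + (LINT x|circle. (m n x)\<^sup>2) / 2"
    using f2i m2i by simp
  finally have "(LINT x|circle. (m n x)\<^sup>2) \<le> (2 * c)\<^sup>2" using main[of n] f2 by (simp add: power_mult_distrib)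
  then have "L2le (m n) (2 * c)" using m2i L2le_nonneg[OF c] by (intro L2leI) auto
  then show ?thesis by (simp add: m_def X_def [abs_def] f_def [abs_def])
qed

section \<open>Widely separated dilations of a step function\<close>

text \<open>
  The kernel \<open>2\<close> to the power \<open>-\<bar>i - j\<bar>\<close>; one of the two truncated differences is always zero.
\<close>

definition geo_decay :: "nat \<Rightarrow> nat \<Rightarrow> real" where
  "geo_decay i j = (1/2) ^ ((i - j) + (j - i))"

lemma geo_decay_commute: "geo_decay i j = geo_decay j i"
  by (simp add: geo_decay_def add.commute)

lemma geo_decay_pos: "geo_decay i j > 0"
  by (simp add: geo_decay_def)

lemma sum_geo_decay: "(\<Sum>j<n. geo_decay i j) \<le> 3"
proof -
  have 1: "(\<Sum>j<k. geo_decay i j) = (1/2) ^ i * (2 ^ k - 1)" if "k \<le> Suc i" for k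
    using that
  proof (induction k)
    case (Suc k)
    then have "geo_decay i k = (1/2) ^ i * 2 ^ k"
      by (simp add: geo_decay_def power_diff power_divide)
    with Suc show ?case by (simp add: algebra_simps)
  qed simp
  \<comment> \<open>The part up to the diagonal contributes less than 2 and the part beyond it less than 1.\<close>
  have 2: "(\<Sum>j<Suc i + m. geo_decay i j) \<le> 3 - (1/2) ^ m" for m
  proof (induction m)
    case 0
    have "(1/2) ^ i * (2 ^ Suc i - 1) \<le> (2::real)" by (simp add: power_divide field_simps)
    then show ?case using 1[of "Suc i"] by simp
  next
    case (Suc m)
    have "geo_decay i (Suc i + m) = (1/2) ^ Suc m" by (simp add: geo_decay_def)
    with Suc show ?case by simp
  qed
  have "(\<Sum>j<n. geo_decay i j) \<le> (\<Sum>j<Suc i + n. geo_decay i j)"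
    using geo_decay_pos by (intro sum_mono2) (auto intro: less_imp_le)
  also have "\<dots> \<le> 3 - (1/2) ^ n" by (rule 2)
  finally show ?thesis using zero_le_power[of "1/2::real" n] by linarith
qed

text \<open>
  Schur's test: the rows and the columns of the kernel have sum at most 3.
\<close>

lemma Schur_geo_decay:
  "(\<Sum>i<n. (\<Sum>j<n. \<bar>a j\<bar> * geo_decay i j)\<^sup>2) \<le> 9 * (\<Sum>j<n. (a j)\<^sup>2)"
proof -
  have "(\<Sum>j<n. \<bar>a j\<bar> * geo_decay i j)\<^sup>2 \<le> 3 * (\<Sum>j<n. (a j)\<^sup>2 * geo_decay i j)" for i
  proof -
    have "(\<Sum>j<n. \<bar>a j\<bar> * geo_decay i j) = (\<Sum>j<n. sqrt (geo_decay i j) * (sqrt (geo_decay i j) * \<bar>a j\<bar>))"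
      using geo_decay_pos by (intro sum.cong) (auto simp: less_imp_le simp flip: mult.assoc)
    also have "\<dots>\<^sup>2 \<le> (\<Sum>j<n. (sqrt (geo_decay i j))\<^sup>2) * (\<Sum>j<n. (sqrt (geo_decay i j) * \<bar>a j\<bar>)\<^sup>2)"
      by (rule Cauchy_Schwarz_ineq_sum)
    also have "\<dots> = (\<Sum>j<n. geo_decay i j) * (\<Sum>j<n. (a j)\<^sup>2 * geo_decay i j)"
      using geo_decay_pos by (simp add: power_mult_distrib less_imp_le mult.commute)
    also have "\<dots> \<le> 3 * (\<Sum>j<n. (a j)\<^sup>2 * geo_decay i j)"
      using geo_decay_pos by (intro mult_right_mono sum_geo_decay sum_nonneg) (simp add: less_imp_le)
    finally show ?thesis .
  qed
  then have "(\<Sum>i<n. (\<Sum>j<n. \<bar>a j\<bar> * geo_decay i j)\<^sup>2) \<le> (\<Sum>i<n. 3 * (\<Sum>j<n. (a j)\<^sup>2 * geo_decay i j))"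
    by (rule sum_mono)
  also have "\<dots> = 3 * (\<Sum>i<n. \<Sum>j<n. (a j)\<^sup>2 * geo_decay i j)"
    by (simp add: sum_distrib_left)
  also have "(\<Sum>i<n. \<Sum>j<n. (a j)\<^sup>2 * geo_decay i j) = (\<Sum>j<n. \<Sum>i<n. (a j)\<^sup>2 * geo_decay j i)"
    by (subst sum.swap) (intro sum.cong; simp add: geo_decay_commute)
  also have "\<dots> = (\<Sum>j<n. (a j)\<^sup>2 * (\<Sum>i<n. geo_decay j i))"
    by (simp only: sum_distrib_left)
  also have "3 * (\<Sum>j<n. (a j)\<^sup>2 * (\<Sum>i<n. geo_decay j i)) \<le> 3 * (\<Sum>j<n. (a j)\<^sup>2 * 3)"
    by (intro mult_left_mono sum_mono sum_geo_decay) auto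
  also have "\<dots> = 9 * (\<Sum>j<n. (a j)\<^sup>2)" by (simp flip: sum_distrib_right)
  finally show ?thesis .
qed

lemma quadratic_geo_decay:
  "(\<Sum>i<n. \<Sum>j<n. \<bar>a i\<bar> * \<bar>a j\<bar> * geo_decay i j) \<le> 3 * (\<Sum>j<n. (a j)\<^sup>2)"
proof -
  have "(\<Sum>i<n. \<Sum>j<n. \<bar>a i\<bar> * \<bar>a j\<bar> * geo_decay i j)
     \<le> (\<Sum>i<n. \<Sum>j<n. (a i)\<^sup>2 / 2 * geo_decay i j + (a j)\<^sup>2 / 2 * geo_decay i j)"
  proof (intro sum_mono)
    fix i j
    have "0 \<le> (\<bar>a i\<bar> - \<bar>a j\<bar>)\<^sup>2" by simp
    then have "\<bar>a i\<bar> * \<bar>a j\<bar> \<le> (a i)\<^sup>2 / 2 + (a j)\<^sup>2 / 2" by (simp add: power2_diff)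
    from mult_right_mono[OF this, of "geo_decay i j"]
    show "\<bar>a i\<bar> * \<bar>a j\<bar> * geo_decay i j \<le> (a i)\<^sup>2 / 2 * geo_decay i j + (a j)\<^sup>2 / 2 * geo_decay i j"
      using geo_decay_pos[of i j] by (simp add: distrib_right less_imp_le)
  qed
  also have "\<dots> = (\<Sum>i<n. \<Sum>j<n. (a i)\<^sup>2 / 2 * geo_decay i j) + (\<Sum>i<n. \<Sum>j<n. (a j)\<^sup>2 / 2 * geo_decay i j)"
    by (simp only: sum.distrib)
  also have "(\<Sum>i<n. \<Sum>j<n. (a j)\<^sup>2 / 2 * geo_decay i j) = (\<Sum>i<n. \<Sum>j<n. (a i)\<^sup>2 / 2 * geo_decay i j)"
    by (subst sum.swap) (intro sum.cong; simp add: geo_decay_commute)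
  also have "(\<Sum>i<n. \<Sum>j<n. (a i)\<^sup>2 / 2 * geo_decay i j) + (\<Sum>i<n. \<Sum>j<n. (a i)\<^sup>2 / 2 * geo_decay i j)
     = (\<Sum>i<n. (a i)\<^sup>2 * (\<Sum>j<n. geo_decay i j))"
    unfolding sum.distrib[symmetric] sum_distrib_left by (intro sum.cong refl) (simp add: field_simps)
  also have "\<dots> \<le> (\<Sum>i<n. (a i)\<^sup>2 * 3)"
    by (intro mult_left_mono sum_mono sum_geo_decay) auto
  also have "\<dots> = 3 * (\<Sum>j<n. (a j)\<^sup>2)" by (simp flip: sum_distrib_right)
  finally show ?thesis .
qed

lemma lacunary_growth:
  fixes N :: "nat \<Rightarrow> nat"
  assumes "\<And>j. N (Suc j) \<ge> R * N j"
  shows "i \<le> j \<Longrightarrow> R ^ (j - i) * N i \<le> N j"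
proof (induction j)
  case (Suc j)
  show ?case
  proof (cases "i = Suc j")
    case False
    then have "i \<le> j" using Suc.prems by simp
    then have "R ^ (Suc j - i) * N i = R * (R ^ (j - i) * N i)" by (simp add: Suc_diff_le)
    also have "\<dots> \<le> R * N j" using Suc.IH \<open>i \<le> j\<close> by simp
    also have "\<dots> \<le> N (Suc j)" by (rule assms)
    finally show ?thesis .
  qed simp
qed simp

lemma power_two_between:
  fixes m :: nat assumes "m > 0"
  shows "m \<le> 2 ^ (LEAST e. m \<le> 2 ^ e)" "2 ^ (LEAST e. m \<le> 2 ^ e) \<le> 2 * m"
proof -
  have ex: "m \<le> 2 ^ m" by (simp add: less_imp_le)
  show "m \<le> 2 ^ (LEAST e. m \<le> 2 ^ e)" using ex by (rule LeastI)
  show "2 ^ (LEAST e. m \<le> 2 ^ e) \<le> 2 * m"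
  proof (cases "LEAST e. m \<le> 2 ^ e")
    case 0
    then show ?thesis using assms by simp
  next
    case (Suc e)
    then have "\<not> m \<le> 2 ^ e" using not_less_Least[of e "\<lambda>e. m \<le> 2 ^ e"] by simp
    then show ?thesis unfolding Suc by simp
  qed
qed

text \<open>
  A step function of order \<open>P\<close> with mean zero, dilated by integers that grow by a factor of at least \<open>P\<^sup>3\<close>.
  Any two dilations then live on scales that are well separated even after allowing for the factor \<open>P\<close>
  between the period and the cells of one dilation.
\<close>

locale separated_dilations =
  fixes g :: "real \<Rightarrow> real" and P :: nat and C c :: real and N :: "nat \<Rightarrow> nat"
  assumes g_measurable [measurable]: "g \<in> borel_measurable borel"
    and per: "\<And>x. g (x + 1) = g x" and step: "cell_step P g" and bd: "\<And>x. \<bar>g x\<bar> \<le> C"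
    and mean: "(LINT x|circle. g x) = 0" and P: "P \<ge> 2" and c: "L2le g c"
    and N: "\<And>j. N j > 0" and growth: "\<And>j. N (Suc j) \<ge> P ^ 3 * N j"
begin

lemma P_pos: "P > 0" using P by simp

lemma c_nonneg: "c \<ge> 0" using c by (rule L2le_nonneg)

lemma int: "integrable circle g" using g_measurable bd by (rule integrable_circle_bounded)

text \<open>
  The scales of a filtration adapted to the dilations: cells of order \<open>Q i\<close> resolve the steps of the
  dilation by \<open>N i\<close>, whose length is \<open>1 / (P N i)\<close>, and are not shorter than a period of the dilation by
  \<open>N (i + 1)\<close>. Powers of two make the partitions nested.
\<close>

definition Q :: "nat \<Rightarrow> nat" where
  "Q i = 2 ^ (LEAST e. N i * P\<^sup>2 \<le> 2 ^ e)"

lemma Q_bounds: "N i * P\<^sup>2 \<le> Q i" "Q i \<le> 2 * (N i * P\<^sup>2)"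
  unfolding Q_def using power_two_between[of "N i * P\<^sup>2"] N P_pos by simp_all

lemma Q_pos: "Q i > 0" by (simp add: Q_def)

lemma Q_dvd: "Q i dvd Q (Suc i)"
proof -
  have "1 * N i \<le> P ^ 3 * N i" using P_pos by (intro mult_right_mono) auto
  then have "N i \<le> N (Suc i)" using growth[of i] by linarith
  then have "N i * P\<^sup>2 \<le> N (Suc i) * P\<^sup>2" by simp
  also have "\<dots> \<le> 2 ^ (LEAST e. N (Suc i) * P\<^sup>2 \<le> 2 ^ e)" using Q_bounds(1) by (simp add: Q_def)
  finally have "(LEAST e. N i * P\<^sup>2 \<le> 2 ^ e) \<le> (LEAST e. N (Suc i) * P\<^sup>2 \<le> 2 ^ e)" by (rule Least_le)
  then show ?thesis unfolding Q_def by (rule le_imp_power_dvd)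
qed

lemma gap: "i \<le> j \<Longrightarrow> real P ^ (3 * (j - i)) * real (N i) \<le> real (N j)"
  using lacunary_growth[where R = "P ^ 3" and N = N, OF growth, of i j]
  by (simp add: power_mult flip: of_nat_power of_nat_mult)

lemma dilate_measurable [measurable]: "(\<lambda>x. g (real (N j) * x)) \<in> borel_measurable borel"
  by measurable

lemma dilate_L2le: "L2le (\<lambda>x. g (real (N j) * x)) c"
  using L2le_dilation[OF c per N] .

lemma dilate_integrable: "integrable circle (\<lambda>x. g (real (N j) * x))"
  using dilate_L2le by (rule L2le_integrable)

lemma two_pow_le: "2 ^ d \<le> real P ^ d"
  using P by (intro power_mono) auto

text \<open>
  The cells of order \<open>Q i\<close> are shorter than the steps of the \<open>j\<close>-th dilation, by a factor that grows geometrically with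
  \<open>i - j\<close>, so most of them contain no jump of that dilation.
\<close>

lemma resolved:
  assumes "j \<le> i"
  shows "L2le (\<lambda>x. g (real (N j) * x) - cell_mean (Q i) (\<lambda>y. g (real (N j) * y)) x) (4 * c * geo_decay i j)"
proof -
  define d where "d = i - j"
  have ratio: "real (P * N j) / real (Q i) \<le> (1/4) ^ d / 2"
  proof -
    have "2 * 4 ^ d * real (P * N j) \<le> real P * (real P ^ (3 * d)) * real (P * N j)"
    proof (intro mult_right_mono mult_mono)
      have "(4::real) ^ d = 2 ^ (2 * d)" by (simp add: power_mult)
      also have "\<dots> \<le> 2 ^ (3 * d)" by (intro power_increasing) auto
      also have "\<dots> \<le> real P ^ (3 * d)" by (rule two_pow_le)
      finally show "(4::real) ^ d \<le> real P ^ (3 * d)" .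
    qed (use P in auto)
    also have "\<dots> = (real P ^ (3 * d) * real (N j)) * real (P\<^sup>2)" by (simp add: power2_eq_square)
    also have "\<dots> \<le> real (N i) * real (P\<^sup>2)" using gap[OF assms] unfolding d_def by (rule mult_right_mono) simp
    also have "\<dots> \<le> real (Q i)" using Q_bounds(1)[of i] by (simp only: of_nat_le_iff flip: of_nat_mult)
    finally show ?thesis using Q_pos[of i] by (simp add: power_divide field_simps)
  qed
  have le1: "real (P * N j) / real (Q i) \<le> 1"
  proof -
    have "(1/4::real) ^ d \<le> 1" by (simp add: power_le_one)
    then show ?thesis using ratio by linarith
  qed
  have PNj: "P * N j > 0" using P_pos N by simp
  have h_le: "1 / real (Q i) \<le> 1 / real (P * N j)"
    using le1 PNj Q_pos[of i] by (simp add: field_simps)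
  have "L2le (\<lambda>x. g (real (N j) * x) - cell_mean (Q i) (\<lambda>y. g (real (N j) * y)) x) (sqrt 2 * (sqrt ((1/4) ^ d * 2) * c))"
  proof (rule L2le_diff_cell_mean[OF dilate_measurable _ dilate_L2le Q_pos])
    show per': "g (real (N j) * (x + 1)) = g (real (N j) * x)" for x
      by (rule periodic_mult_nat[of g, OF per])
    fix h assume h: "0 \<le> h" "h \<le> 1 / real (Q i)"
    then have "h \<le> 1 / real (P * N j)" using h_le by linarith
    then have *: "L2le (\<lambda>x. g (real (N j) * (x + h)) - g (real (N j) * x)) (sqrt (4 * h * real (P * N j)) * c)"
      by (intro L2le_step_shift[OF dilate_measurable per' cell_step_dilation[OF step] PNj h(1) _ dilate_L2le])
    have "h * real (P * N j) \<le> 1 / real (Q i) * real (P * N j)" using h by (intro mult_right_mono) auto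
    also have "1 / real (Q i) * real (P * N j) = real (P * N j) / real (Q i)" by simp
    finally have "4 * h * real (P * N j) \<le> (1/4) ^ d * 2" using ratio by linarith
    then have "sqrt (4 * h * real (P * N j)) * c \<le> sqrt ((1/4) ^ d * 2) * c"
      using c_nonneg by (intro mult_right_mono) auto
    with * show "L2le (\<lambda>x. g (real (N j) * (x + h)) - g (real (N j) * x)) (sqrt ((1/4) ^ d * 2) * c)"
      by (rule L2le_weaken)
  qed
  moreover have "sqrt 2 * (sqrt ((1/4) ^ d * 2) * c) \<le> 4 * c * geo_decay i j"
  proof -
    have "(1/4::real) ^ d = ((1/2) ^ d)\<^sup>2" by (simp add: power2_eq_square flip: power_mult_distrib)
    then have "sqrt 2 * sqrt ((1/4) ^ d * 2) = 2 * (1/2) ^ d" by (simp add: real_sqrt_mult)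
    then have "sqrt 2 * (sqrt ((1/4) ^ d * 2) * c) = 2 * c * (1/2) ^ d" by (simp flip: mult.assoc)
    also have "\<dots> \<le> 4 * c * (1/2) ^ d" using c_nonneg by (intro mult_right_mono) auto
    also have "(1/2) ^ d = geo_decay i j" using assms by (simp add: geo_decay_def d_def)
    finally show ?thesis .
  qed
  ultimately show ?thesis by (rule L2le_weaken)
qed

lemma decay_aux:
  assumes "i < j" shows "(real P)\<^sup>2 * real (N i) / real (N j) \<le> geo_decay i j"
proof -
  define d where "d = j - i"
  have d: "d \<ge> 1" using assms by (simp add: d_def)
  have "2 ^ d * ((real P)\<^sup>2 * real (N i)) \<le> real P ^ d * ((real P)\<^sup>2 * real (N i))"
    by (intro mult_right_mono two_pow_le) simp
  also have "\<dots> = real P ^ (d + 2) * real (N i)" by (simp add: power_add power2_eq_square)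
  also have "\<dots> \<le> real P ^ (3 * d) * real (N i)"
    using d P by (intro mult_right_mono power_increasing) auto
  also have "\<dots> \<le> real (N j)" using gap[of i j] assms by (simp add: d_def)
  finally have "(real P)\<^sup>2 * real (N i) \<le> (1/2) ^ d * real (N j)" by (simp add: power_divide field_simps)
  then have "(real P)\<^sup>2 * real (N i) / real (N j) \<le> (1/2) ^ d" using N[of j] by (simp add: pos_divide_le_eq)
  also have "(1/2) ^ d = geo_decay i j" using assms by (simp add: geo_decay_def d_def)
  finally show ?thesis .
qed

text \<open>
  A cell of order \<open>Q i\<close> contains a number of periods of the \<open>j\<close>-th dilation that grows geometrically with \<open>j - i\<close>, and only
  the incomplete periods at its ends contribute to the average.
\<close>

lemma averaged_out:
  assumes "i < j"
  shows "L2le (cell_mean (Q i) (\<lambda>y. g (real (N j) * y))) (4 * c * geo_decay i j)"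
proof (rule L2le_const_bound)
  show "cell_mean (Q i) (\<lambda>y. g (real (N j) * y)) \<in> borel_measurable borel" by measurable
  fix x
  have "\<bar>cell_mean (Q i) (\<lambda>y. g (real (N j) * y)) x\<bar> \<le> 2 * real (Q i) / real (N j) * (LINT x|circle. \<bar>g x\<bar>)"
    by (rule abs_cell_mean_dilation[OF g_measurable per int mean N Q_pos])
  also have "\<dots> \<le> 2 * (2 * ((real P)\<^sup>2 * real (N i))) / real (N j) * c"
  proof (intro mult_mono divide_right_mono mult_left_mono)
    show "real (Q i) \<le> 2 * ((real P)\<^sup>2 * real (N i))" 
      using Q_bounds(2)[of i] by (simp add: mult.commute flip: of_nat_power of_nat_mult)
    show "(LINT x|circle. \<bar>g x\<bar>) \<le> c" by (rule L2le_integral_abs[OF c])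
  qed auto
  also have "\<dots> = 4 * c * ((real P)\<^sup>2 * real (N i) / real (N j))" by simp
  also have "\<dots> \<le> 4 * c * geo_decay i j" using decay_aux[OF assms] c_nonneg by (intro mult_left_mono) auto
  finally show "\<bar>cell_mean (Q i) (\<lambda>y. g (real (N j) * y)) x\<bar> \<le> 4 * c * geo_decay i j" .
qed

lemma quasi_orthogonal:
  "\<bar>LINT x|circle. g (real (N i) * x) * g (real (N j) * x)\<bar> \<le> 2 * c\<^sup>2 * geo_decay i j"
proof -
  have lt: "\<bar>LINT x|circle. g (real (N i) * x) * g (real (N j) * x)\<bar> \<le> 2 * c\<^sup>2 * geo_decay i j" if "i < j" for i j
  proof -
    have "\<bar>LINT x|circle. g (real (N i) * x) * g (real (N j) * x)\<bar> \<le> 2 * real (P * N i) / real (N j) * (LINT x|circle. \<bar>g x\<bar>)\<^sup>2"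
      by (rule abs_integral_mult_dilations[OF g_measurable per step bd mean P_pos N N])
    also have "\<dots> \<le> 2 * ((real P)\<^sup>2 * real (N i)) / real (N j) * c\<^sup>2"
    proof (intro mult_mono divide_right_mono mult_left_mono power_mono)
      show "(LINT x|circle. \<bar>g x\<bar>) \<le> c" by (rule L2le_integral_abs[OF c])
      have "real P * 1 \<le> real P * real P" using P by (intro mult_left_mono) auto
      then have "real P * 1 * real (N i) \<le> real P * real P * real (N i)" by (rule mult_right_mono) simp
      then show "real (P * N i) \<le> (real P)\<^sup>2 * real (N i)" by (simp add: power2_eq_square)
    qed auto
    also have "\<dots> = 2 * c\<^sup>2 * ((real P)\<^sup>2 * real (N i) / real (N j))" by simp
    also have "\<dots> \<le> 2 * c\<^sup>2 * geo_decay i j" using decay_aux[OF that] by (intro mult_left_mono) auto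
    finally show ?thesis .
  qed
  consider "i < j" | "j < i" | "i = j" by linarith
  then show ?thesis
  proof cases
    case 1 then show ?thesis by (rule lt)
  next
    case 2 then show ?thesis using lt[OF 2] by (simp add: mult.commute geo_decay_commute)
  next
    case 3
    have "(LINT x|circle. (g (real (N j) * x))\<^sup>2) \<le> c\<^sup>2" by (rule L2le_integral_square[OF dilate_L2le])
    moreover have "0 \<le> (LINT x|circle. (g (real (N j) * x))\<^sup>2)" by simp
    ultimately have "\<bar>LINT x|circle. (g (real (N j) * x))\<^sup>2\<bar> \<le> 2 * c\<^sup>2"
      using zero_le_power2[of c] by linarith
    then show ?thesis using 3 by (simp add: geo_decay_def flip: power2_eq_square)
  qed
qed

lemma L2le_dilation_sum:
  "L2le (\<lambda>x. \<Sum>j<n. a j * g (real (N j) * x)) (3 * c * sqrt (\<Sum>j<n. (a j)\<^sup>2))"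
proof (rule L2leI)
  let ?g = "\<lambda>j x. g (real (N j) * x)"
  show "(\<lambda>x. \<Sum>j<n. a j * ?g j x) \<in> borel_measurable borel" by measurable
  show "0 \<le> 3 * c * sqrt (\<Sum>j<n. (a j)\<^sup>2)" using c_nonneg by (simp add: sum_nonneg)
  have ii: "integrable circle (\<lambda>x. ?g i x * ?g j x)" for i j
  proof (rule integrable_circle_bounded[where C = "C * C"])
    show "\<bar>?g i x * ?g j x\<bar> \<le> C * C" for x
      unfolding abs_mult using bd[of "real (N i) * x"] bd[of "real (N j) * x"] by (intro mult_mono) auto
  qed measurable
  have sq: "(\<Sum>j<n. a j * ?g j x)\<^sup>2 = (\<Sum>i<n. \<Sum>j<n. (a i * a j) * (?g i x * ?g j x))" for x
    by (simp add: power2_eq_square sum_product mult_ac)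
  show "integrable circle (\<lambda>x. (\<Sum>j<n. a j * ?g j x)\<^sup>2)"
    unfolding sq using ii by (intro Bochner_Integration.integrable_sum integrable_mult_right)
  have "(LINT x|circle. (\<Sum>j<n. a j * ?g j x)\<^sup>2) = (\<Sum>i<n. \<Sum>j<n. (a i * a j) * (LINT x|circle. ?g i x * ?g j x))"
    unfolding sq using ii by (simp add: Bochner_Integration.integral_sum)
  also have "\<dots> \<le> (\<Sum>i<n. \<Sum>j<n. 2 * c\<^sup>2 * (\<bar>a i\<bar> * \<bar>a j\<bar> * geo_decay i j))"
  proof (intro sum_mono)
    fix i j
    have "(a i * a j) * (LINT x|circle. ?g i x * ?g j x) \<le> \<bar>a i * a j\<bar> * \<bar>LINT x|circle. ?g i x * ?g j x\<bar>"
      by (metis abs_ge_self abs_mult)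
    also have "\<dots> \<le> \<bar>a i * a j\<bar> * (2 * c\<^sup>2 * geo_decay i j)"
      by (intro mult_left_mono quasi_orthogonal) simp
    finally show "(a i * a j) * (LINT x|circle. ?g i x * ?g j x) \<le> 2 * c\<^sup>2 * (\<bar>a i\<bar> * \<bar>a j\<bar> * geo_decay i j)"
      by (simp add: abs_mult mult_ac)
  qed
  also have "\<dots> = 2 * c\<^sup>2 * (\<Sum>i<n. \<Sum>j<n. \<bar>a i\<bar> * \<bar>a j\<bar> * geo_decay i j)"
    by (simp add: sum_distrib_left)
  also have "\<dots> \<le> 2 * c\<^sup>2 * (3 * (\<Sum>j<n. (a j)\<^sup>2))"
    by (intro mult_left_mono quadratic_geo_decay) simp
  also have "\<dots> \<le> 9 * c\<^sup>2 * (\<Sum>j<n. (a j)\<^sup>2)" by (simp add: sum_nonneg)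
  also have "\<dots> = (3 * c * sqrt (\<Sum>j<n. (a j)\<^sup>2))\<^sup>2" by (simp add: power_mult_distrib sum_nonneg)
  finally show "(LINT x|circle. (\<Sum>j<n. a j * ?g j x)\<^sup>2) \<le> (3 * c * sqrt (\<Sum>j<n. (a j)\<^sup>2))\<^sup>2" .
qed

text \<open>
  By the two estimates above, the partial sum up to index \<open>i\<close> is the average of the full sum \<open>F\<close> over the cells
  of order \<open>Q i\<close> up to an error \<open>E i\<close>. The averages are controlled by Doob's inequality and
  quasi-orthogonality. The errors decay geometrically off the diagonal, so by Schur's test even their square
  function is bounded. The constant is \<open>18 = 2 * 3 + 12\<close>: Doob's constant times that of \<open>L2le_dilation_sum\<close>, plus the
  contribution of the errors.
\<close>

lemma maximal_inequality:
  "\<exists>W. L2le W (18 * c * sqrt (\<Sum>j<n. (a j)\<^sup>2)) \<and>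
       (\<forall>x. \<forall>J\<le>n. \<bar>\<Sum>j<J. a j * g (real (N j) * x)\<bar> \<le> W x)"
proof -
  let ?g = "\<lambda>j x. g (real (N j) * x)"
  let ?A = "sqrt (\<Sum>j<n. (a j)\<^sup>2)"
  define F where "F x = (\<Sum>j<n. a j * ?g j x)" for x
  define X where "X i = cell_mean (Q i) (\<lambda>x. \<bar>F x\<bar>)" for i
  define e where "e i j x = (if j \<le> i then ?g j x - cell_mean (Q i) (?g j) x else - cell_mean (Q i) (?g j) x)" for i j x
  define E where "E i x = (\<Sum>j<n. a j * e i j x)" for i x
  define W where "W x = running_max X n x + sqrt (\<Sum>i<n. (E i x)\<^sup>2)" for x
  have F [measurable]: "F \<in> borel_measurable borel" unfolding F_def by measurable
  have Fbd: "\<bar>F x\<bar> \<le> (\<Sum>j<n. \<bar>a j\<bar> * C)" for x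
    unfolding F_def by (rule order_trans[OF sum_abs]) (auto simp: abs_mult intro!: sum_mono mult_left_mono bd)
  have FL: "L2le F (3 * c * ?A)" unfolding F_def by (rule L2le_dilation_sum)
  have max_L2: "L2le (running_max X n) (2 * (3 * c * ?A))"
    unfolding X_def by (rule Doob_cell_mean[where Q = Q, OF F Fbd Q_pos Q_dvd FL])
  have e_L2: "L2le (e i j) (4 * c * geo_decay i j)" for i j
  proof (cases "j \<le> i")
    case True
    then show ?thesis using resolved[OF True] by (simp add: e_def[abs_def])
  next
    case False
    then have "L2le (\<lambda>x. -1 * cell_mean (Q i) (?g j) x) (\<bar>-1\<bar> * (4 * c * geo_decay i j))"
      by (intro L2le_scale averaged_out) simp
    then show ?thesis using False by (simp add: e_def[abs_def])
  qed
  have E_L2: "L2le (E i) (4 * c * (\<Sum>j<n. \<bar>a j\<bar> * geo_decay i j))" for i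
  proof -
    have "L2le (E i) (\<Sum>j<n. \<bar>a j\<bar> * (4 * c * geo_decay i j))"
      unfolding E_def by (intro L2le_sum L2le_scale e_L2) simp
    then show ?thesis by (simp add: sum_distrib_left mult_ac)
  qed
  have "L2le (\<lambda>x. sqrt (\<Sum>i<n. (E i x)\<^sup>2)) (sqrt (\<Sum>i<n. (4 * c * (\<Sum>j<n. \<bar>a j\<bar> * geo_decay i j))\<^sup>2))"
    by (intro L2le_square_sum E_L2) simp
  moreover have "sqrt (\<Sum>i<n. (4 * c * (\<Sum>j<n. \<bar>a j\<bar> * geo_decay i j))\<^sup>2) \<le> 12 * c * ?A"
  proof (rule real_le_lsqrt)
    have "(\<Sum>i<n. (4 * c * (\<Sum>j<n. \<bar>a j\<bar> * geo_decay i j))\<^sup>2) = 16 * c\<^sup>2 * (\<Sum>i<n. (\<Sum>j<n. \<bar>a j\<bar> * geo_decay i j)\<^sup>2)"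
      by (simp add: power_mult_distrib flip: sum_distrib_left)
    also have "\<dots> \<le> 16 * c\<^sup>2 * (9 * (\<Sum>j<n. (a j)\<^sup>2))"
      by (intro mult_left_mono Schur_geo_decay) simp
    also have "\<dots> = (12 * c * ?A)\<^sup>2" by (simp add: power_mult_distrib sum_nonneg)
    finally show "(\<Sum>i<n. (4 * c * (\<Sum>j<n. \<bar>a j\<bar> * geo_decay i j))\<^sup>2) \<le> (12 * c * ?A)\<^sup>2" .
  qed (use c_nonneg in \<open>simp_all add: sum_nonneg\<close>)
  ultimately have "L2le (\<lambda>x. sqrt (\<Sum>i<n. (E i x)\<^sup>2)) (12 * c * ?A)" by (rule L2le_weaken)
  from L2le_add[OF max_L2 this] have WL: "L2le W (18 * c * ?A)" by (simp add: W_def[abs_def] mult.assoc)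
  have "\<bar>\<Sum>j<J. a j * ?g j x\<bar> \<le> W x" if "J \<le> n" for x J
  proof (cases J)
    case 0
    have "0 \<le> X 0 x" unfolding X_def by (rule cell_mean_nonneg) simp
    then have "0 \<le> running_max X n x" using running_max_ge[of 0 n X x] by simp
    then show ?thesis using 0 by (simp add: W_def sum_nonneg)
  next
    case (Suc i)
    then have i: "i < n" using that by simp
    have "(\<Sum>j<J. a j * ?g j x) = (\<Sum>j<n. if j \<le> i then a j * ?g j x else 0)"
      by (rule sum.mono_neutral_cong_left) (use i Suc in auto)
    also have "\<dots> = (\<Sum>j<n. a j * e i j x + a j * cell_mean (Q i) (?g j) x)"
      by (intro sum.cong) (auto simp: e_def algebra_simps)
    also have "\<dots> = E i x + cell_mean (Q i) F x"
      using cell_mean_sum[of "{..<n}" ?g "Q i" a x] dilate_integrable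
      by (simp add: sum.distrib E_def F_def[abs_def])
    finally have "\<bar>\<Sum>j<J. a j * ?g j x\<bar> \<le> \<bar>E i x\<bar> + \<bar>cell_mean (Q i) F x\<bar>" by linarith
    also have "\<bar>cell_mean (Q i) F x\<bar> \<le> X i x" 
      unfolding X_def by (rule abs_cell_mean_le[OF L2le_integrable[OF FL]])
    also have "X i x \<le> running_max X n x" using i by (intro running_max_ge) simp
    also have "\<bar>E i x\<bar> \<le> sqrt (\<Sum>i<n. (E i x)\<^sup>2)"
      by (rule real_le_rsqrt) (use i in \<open>auto intro!: member_le_sum\<close>)
    finally show ?thesis by (simp add: W_def)
  qed
  with WL show ?thesis by blast
qed

end

section \<open>Hadamard lacunary dilations of a step function\<close>

lemma residue_index_less_iff:
  assumes "r < R"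
  shows "j < (J + (R - 1 - r)) div R \<longleftrightarrow> r + j * R < (J :: nat)"
proof -
  have "R > 0" using assms by simp
  have "j < (J + (R - 1 - r)) div R \<longleftrightarrow> \<not> (J + (R - 1 - r)) div R < Suc j" by auto
  also have "\<dots> \<longleftrightarrow> \<not> J + (R - 1 - r) < Suc j * R" using div_less_iff_less_mult[OF \<open>R > 0\<close>] by simp
  also have "\<dots> \<longleftrightarrow> r + j * R < J" using assms by auto
  finally show ?thesis .
qed

text \<open>
  The residue class of \<open>r\<close> modulo \<open>R\<close> has \<open>(J + (R - 1 - r)) div R\<close> members below \<open>J\<close>. They form an initial segment of the
  class, so a partial sum over all indices is a sum of partial sums over the classes.
\<close>

lemma sum_residue_classes:
  fixes h :: "nat \<Rightarrow> real"
  assumes R: "R > 0"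
  shows "(\<Sum>k<J. h k) = (\<Sum>r<R. \<Sum>j<(J + (R - 1 - r)) div R. h (r + j * R))"
proof -
  have "(\<Sum>k<J. h k) = (\<Sum>r<R. \<Sum>k | k \<in> {..<J} \<and> k mod R = r. h k)"
    using R by (intro sum.group[symmetric]) auto
  also have "\<dots> = (\<Sum>r<R. \<Sum>j<(J + (R - 1 - r)) div R. h (r + j * R))"
  proof (rule sum.cong[OF refl])
    fix r assume "r \<in> {..<R}"
    then have r: "r < R" by simp
    have "bij_betw (\<lambda>j. r + j * R) {..<(J + (R - 1 - r)) div R} {k. k \<in> {..<J} \<and> k mod R = r}"
    proof (rule bij_betwI[where g = "\<lambda>k. k div R"])
      show "(\<lambda>k. k div R) \<in> {k. k \<in> {..<J} \<and> k mod R = r} \<rightarrow> {..<(J + (R - 1 - r)) div R}"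
      proof
        fix k assume k: "k \<in> {k. k \<in> {..<J} \<and> k mod R = r}"
        then have "r + k div R * R = k" using mod_div_mult_eq[of k R] by simp
        then show "k div R \<in> {..<(J + (R - 1 - r)) div R}" using k residue_index_less_iff[OF r, of "k div R"] by simp
      qed
    qed (use r R residue_index_less_iff[OF r] mod_div_mult_eq in auto)
    then show "(\<Sum>k | k \<in> {..<J} \<and> k mod R = r. h k) = (\<Sum>j<(J + (R - 1 - r)) div R. h (r + j * R))"
      by (rule sum.reindex_bij_betw[symmetric])
  qed
  finally show ?thesis .
qed

lemma real_lacunary_growth:
  fixes n :: "nat \<Rightarrow> nat"
  assumes "\<And>k. real (n (Suc k)) \<ge> q * real (n k)" "q > 0"
  shows "real (n (k + m)) \<ge> q ^ m * real (n k)"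
proof (induction m)
  case (Suc m)
  have "q ^ Suc m * real (n k) = q * (q ^ m * real (n k))" by simp
  also have "\<dots> \<le> q * real (n (k + m))" using Suc assms(2) by (intro mult_left_mono) auto
  also have "\<dots> \<le> real (n (k + Suc m))" using assms(1)[of "k + m"] by simp
  finally show ?case .
qed simp

lemma sum_sqrt_le:
  assumes "\<And>r. r < R \<Longrightarrow> (A r :: real) \<ge> 0"
  shows "(\<Sum>r<R. sqrt (A r)) \<le> sqrt (real R) * sqrt (\<Sum>r<R. A r)"
proof -
  have "(\<Sum>r<R. 1 * sqrt (A r))\<^sup>2 \<le> (\<Sum>r<R. 1\<^sup>2) * (\<Sum>r<R. (sqrt (A r))\<^sup>2)"
    by (rule Cauchy_Schwarz_ineq_sum)
  also have "(\<Sum>r<R. (sqrt (A r))\<^sup>2) = (\<Sum>r<R. A r)" using assms by (intro sum.cong) auto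
  finally have "(\<Sum>r<R. sqrt (A r))\<^sup>2 \<le> real R * (\<Sum>r<R. A r)" by simp
  then have "(\<Sum>r<R. sqrt (A r)) \<le> sqrt (real R * (\<Sum>r<R. A r))" by (rule real_le_rsqrt)
  then show ?thesis by (simp add: real_sqrt_mult)
qed

text \<open>
  A lacunary sequence is split into \<open>R = D M\<close> residue classes of the index, each of which is separated in the
  sense of the locale because \<open>q\<close> to the power \<open>R\<close> is at least the cube of \<open>2\<close> to the power \<open>M\<close>. Adding the \<open>R\<close> maximal
  functions costs a factor \<open>sqrt R\<close> by the Cauchy-Schwarz inequality. This loss is the origin of the
  factor \<open>1 / sqrt m\<close> in the hypothesis on the modulus of continuity.
\<close>

lemma maximal_inequality_step:
  fixes n :: "nat \<Rightarrow> nat" and a :: "nat \<Rightarrow> real"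
  assumes g: "g \<in> borel_measurable borel" and per: "\<And>x. g (x + 1) = g x"
    and step: "cell_step (2 ^ M) g" and M: "M \<ge> 1" and bd: "\<And>x. \<bar>g x\<bar> \<le> C"
    and mean: "(LINT x|circle. g x) = 0" and c: "L2le g c"
    and n: "\<And>k. n k > 0" "\<And>k. real (n (Suc k)) \<ge> q * real (n k)"
    and q: "q > 1" and D: "q ^ D \<ge> 8"
  shows "\<exists>W. L2le W (18 * c * sqrt (real (D * M)) * sqrt (\<Sum>k<l. (a k)\<^sup>2)) \<and>
       (\<forall>x. \<forall>J\<le>l. \<bar>\<Sum>k<J. a k * g (real (n k) * x)\<bar> \<le> W x)"
proof -
  define R where "R = D * M"
  have "D \<noteq> 0"
  proof
    assume "D = 0" with D show False by simp
  qed
  then have R: "R > 0" using M by (simp add: R_def)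
  define b where "b r j = (if r + j * R < l then a (r + j * R) else 0)" for r j
  have c0: "c \<ge> 0" using c by (rule L2le_nonneg)
  have "\<exists>W. L2le W (18 * c * sqrt (\<Sum>j<l. (b r j)\<^sup>2)) \<and>
       (\<forall>x. \<forall>J\<le>l. \<bar>\<Sum>j<J. b r j * g (real (n (r + j * R)) * x)\<bar> \<le> W x)" for r
  proof -
    have "separated_dilations g (2 ^ M) C c (\<lambda>j. n (r + j * R))"
    proof
      show "(2::nat) \<le> 2 ^ M" using M power_increasing[of 1 M "2::nat"] by simp
      fix j
      have "real ((2 ^ M) ^ 3 * n (r + j * R)) = 8 ^ M * real (n (r + j * R))"
        using power_mult[of "2::real" 3 M] by (simp add: mult.commute[of M 3] flip: power_mult)
      also have "\<dots> \<le> (q ^ D) ^ M * real (n (r + j * R))" using D by (intro mult_right_mono power_mono) auto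
      also have "\<dots> = q ^ R * real (n (r + j * R))" by (simp add: R_def power_mult)
      also have "\<dots> \<le> real (n (r + j * R + R))" using q n(2) by (intro real_lacunary_growth) auto
      finally have "real ((2 ^ M) ^ 3 * n (r + j * R)) \<le> real (n (r + Suc j * R))" by (simp add: add_ac)
      then show "(2 ^ M) ^ 3 * n (r + j * R) \<le> n (r + Suc j * R)" by (simp only: of_nat_le_iff)
    qed (use g per step bd mean c n in auto)
    then show ?thesis by (rule separated_dilations.maximal_inequality)
  qed
  then have "\<forall>r. \<exists>W. L2le W (18 * c * sqrt (\<Sum>j<l. (b r j)\<^sup>2)) \<and>
       (\<forall>x. \<forall>J\<le>l. \<bar>\<Sum>j<J. b r j * g (real (n (r + j * R)) * x)\<bar> \<le> W x)" by (rule allI)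
  from choice[OF this] obtain W where WL: "\<And>r. L2le (W r) (18 * c * sqrt (\<Sum>j<l. (b r j)\<^sup>2))"
    and Wx: "\<And>r x J. J \<le> l \<Longrightarrow> \<bar>\<Sum>j<J. b r j * g (real (n (r + j * R)) * x)\<bar> \<le> W r x"
    by blast
  have L_le: "(J + (R - 1 - r)) div R \<le> l" if "J \<le> l" "r < R" for J r
  proof (rule ccontr)
    assume "\<not> ?thesis"
    then have "l < (J + (R - 1 - r)) div R" by simp
    then have "r + l * R < J" using residue_index_less_iff[OF that(2)] by simp
    moreover have "l \<le> l * R" using R by simp
    ultimately show False using that by linarith
  qed
  have part: "(\<Sum>k<J. a k * g (real (n k) * x)) = (\<Sum>r<R. \<Sum>j<(J + (R - 1 - r)) div R. b r j * g (real (n (r + j * R)) * x))"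
    if "J \<le> l" for J x
  proof (subst sum_residue_classes[OF R], intro sum.cong refl)
    fix r j assume "r \<in> {..<R}" "j \<in> {..<(J + (R - 1 - r)) div R}"
    then have "r + j * R < l" using residue_index_less_iff[of r R j J] that by simp
    then show "a (r + j * R) * g (real (n (r + j * R)) * x) = b r j * g (real (n (r + j * R)) * x)"
      by (simp add: b_def)
  qed
  have sq: "(\<Sum>r<R. \<Sum>j<l. (b r j)\<^sup>2) = (\<Sum>k<l. (a k)\<^sup>2)"
    unfolding sum_residue_classes[OF R, of "\<lambda>k. (a k)\<^sup>2" l]
  proof (rule sum.cong[OF refl])
    fix r assume "r \<in> {..<R}"
    then have r: "r < R" by simp
    have "(\<Sum>j<(l + (R - 1 - r)) div R. (a (r + j * R))\<^sup>2) = (\<Sum>j<(l + (R - 1 - r)) div R. (b r j)\<^sup>2)"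
      using residue_index_less_iff[OF r] by (intro sum.cong) (auto simp: b_def)
    also have "\<dots> = (\<Sum>j<l. (b r j)\<^sup>2)"
    proof (rule sum.mono_neutral_left)
      show "{..<(l + (R - 1 - r)) div R} \<subseteq> {..<l}" using L_le[OF order_refl r] by simp
      show "\<forall>j\<in>{..<l} - {..<(l + (R - 1 - r)) div R}. (b r j)\<^sup>2 = 0"
      proof
        fix j assume "j \<in> {..<l} - {..<(l + (R - 1 - r)) div R}"
        then have "\<not> r + j * R < l" using residue_index_less_iff[OF r, of j l] by simp
        then show "(b r j)\<^sup>2 = 0" by (simp add: b_def)
      qed
    qed simp
    finally show "(\<Sum>j<l. (b r j)\<^sup>2) = (\<Sum>j<(l + (R - 1 - r)) div R. (a (r + j * R))\<^sup>2)" by simp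
  qed
  have "L2le (\<lambda>x. \<Sum>r<R. W r x) (\<Sum>r<R. 18 * c * sqrt (\<Sum>j<l. (b r j)\<^sup>2))"
    by (intro L2le_sum WL) simp
  moreover have "(\<Sum>r<R. 18 * c * sqrt (\<Sum>j<l. (b r j)\<^sup>2)) \<le> 18 * c * sqrt (real (D * M)) * sqrt (\<Sum>k<l. (a k)\<^sup>2)"
  proof -
    have "18 * c * (\<Sum>r<R. sqrt (\<Sum>j<l. (b r j)\<^sup>2)) \<le> 18 * c * (sqrt (real R) * sqrt (\<Sum>r<R. \<Sum>j<l. (b r j)\<^sup>2))"
      using c0 by (intro mult_left_mono sum_sqrt_le sum_nonneg) auto
    then show ?thesis unfolding sq by (simp only: sum_distrib_left R_def mult.assoc)
  qed
  ultimately have "L2le (\<lambda>x. \<Sum>r<R. W r x) (18 * c * sqrt (real (D * M)) * sqrt (\<Sum>k<l. (a k)\<^sup>2))"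
    by (rule L2le_weaken)
  moreover have "\<bar>\<Sum>k<J. a k * g (real (n k) * x)\<bar> \<le> (\<Sum>r<R. W r x)" if "J \<le> l" for J x
    unfolding part[OF that] by (rule order_trans[OF sum_abs], rule sum_mono) (use L_le[OF that] Wx in auto)
  ultimately show ?thesis by blast
qed

section \<open>From the modulus of continuity to a maximal inequality\<close>

text \<open>
  The function is expanded into the telescoping sum of the differences \<open>G\<close> of its averages over cells of order
  \<open>2 ^ 2 ^ m\<close>. The difference \<open>G (m + 1)\<close> has norm at most \<open>3 * w (2 ^ m)\<close>, and its maximal function
  costs a factor of order \<open>sqrt (2 ^ m)\<close>. By Cauchy condensation the sum of these products converges together with the sum
  of \<open>w m / sqrt m\<close>. The number \<open>\<eta>\<close> absorbs the remainder of the expansion; only finitely many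
  dilations are involved at a time, so convergence in \<open>L\<^sup>2\<close> suffices for it.
\<close>

lemma maximal_inequality_modulus:
  fixes n :: "nat \<Rightarrow> nat" and u :: "real \<Rightarrow> real" and w :: "nat \<Rightarrow> real"
  assumes u [measurable]: "u \<in> borel_measurable borel" and per: "\<And>x. u (x + 1) = u x"
    and c: "L2le u c" and mean: "(LINT x|circle. u x) = 0"
    and \<omega>: "\<And>L h. 0 \<le> h \<Longrightarrow> h \<le> (1/2) ^ L \<Longrightarrow> L2le (\<lambda>x. u (x + h) - u x) (w L)"
    and anti: "\<And>L. w (Suc L) \<le> w L"
    and summ: "summable (\<lambda>m. w (Suc m) / sqrt (real (Suc m)))"
    and n: "\<And>k. n k > 0" "\<And>k. real (n (Suc k)) \<ge> q * real (n k)" and q: "q > 1"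
  shows "\<exists>B\<ge>0. \<forall>(a :: nat \<Rightarrow> real) l \<eta>. \<eta> > 0 \<longrightarrow> (\<exists>W. L2le W (B * sqrt (\<Sum>k<l. (a k)\<^sup>2) + \<eta>) \<and>
       (\<forall>x. \<forall>J\<le>l. \<bar>\<Sum>k<J. a k * u (real (n k) * x)\<bar> \<le> W x))"
proof -
  obtain D where D: "q ^ D > 8" using real_arch_pow[OF q] by blast
  have w0: "w L \<ge> 0" for L using \<omega>[of 0 L] L2le_nonneg by auto
  have ui: "integrable circle u" using c by (rule L2le_integrable)
  define A where "A p = cell_mean (2 ^ 2 ^ p) u" for p :: nat
  define G where "G m = (case m of 0 \<Rightarrow> A 0 | Suc m' \<Rightarrow> (\<lambda>x. A (Suc m') x - A m' x))" for m
  define d where "d m = (case m of 0 \<Rightarrow> c + sqrt 2 * w 1 | Suc m' \<Rightarrow> 3 * w (2 ^ m'))" for m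
  have A_meas [measurable]: "A p \<in> borel_measurable borel" for p unfolding A_def by measurable
  have uA: "L2le (\<lambda>x. u x - A p x) (sqrt 2 * w (2 ^ p))" for p
    unfolding A_def
  proof (rule L2le_diff_cell_mean[OF u per c])
    fix h :: real assume "0 \<le> h" "h \<le> 1 / real (2 ^ 2 ^ p)"
    then show "L2le (\<lambda>x. u (x + h) - u x) (w (2 ^ p))" by (intro \<omega>) (auto simp: power_divide)
  qed simp
  have A_step: "cell_step (2 ^ 2 ^ p) (A p)" for p unfolding A_def by (rule cell_step_cell_mean) simp
  have A_per: "A p (x + 1) = A p x" for p x unfolding A_def by (rule cell_mean_periodic)
  have A_bd: "\<bar>A p x\<bar> \<le> 2 ^ 2 ^ p * (LINT y|circle. \<bar>u y\<bar>)" for p x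
    using cell_mean_bounded[OF ui, of "2 ^ 2 ^ p" x] by (simp add: A_def)
  have A_int: "integrable circle (A p)" for p using A_meas A_bd by (rule integrable_circle_bounded)
  have A_mean: "(LINT x|circle. A p x) = 0" for p
    unfolding A_def by (subst integral_cell_mean[OF u ui]) (simp_all add: mean)
  have G_meas [measurable]: "G m \<in> borel_measurable borel" for m
    unfolding G_def by (cases m) simp_all
  have G_per: "G m (x + 1) = G m x" for m x by (cases m) (simp_all add: G_def A_per)
  have G_step: "cell_step (2 ^ 2 ^ m) (G m)" for m
  proof (cases m)
    case 0
    then show ?thesis using A_step[of 0] by (simp add: G_def)
  next
    case (Suc m')
    have "cell_step (2 ^ 2 ^ Suc m') (A m')"
      by (rule cell_step_dvd[OF A_step]) (auto intro!: le_imp_power_dvd power_increasing)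
    from cell_step_compose2[OF A_step[of "Suc m'"] this, of "\<lambda>s t. s - t"]
    show ?thesis by (simp add: G_def Suc)
  qed
  have G_bd: "\<exists>C. \<forall>x. \<bar>G m x\<bar> \<le> C" for m
  proof (cases m)
    case 0
    then show ?thesis using A_bd[of 0] by (auto simp: G_def)
  next
    case (Suc m')
    have "\<bar>G m x\<bar> \<le> 2 ^ 2 ^ Suc m' * (LINT y|circle. \<bar>u y\<bar>) + 2 ^ 2 ^ m' * (LINT y|circle. \<bar>u y\<bar>)" for x
      using A_bd[of "Suc m'" x] A_bd[of m' x] unfolding G_def Suc by simp
    then show ?thesis by blast
  qed
  have G_mean: "(LINT x|circle. G m x) = 0" for m
    using A_int A_mean by (cases m) (simp_all add: G_def)
  have G_L2: "L2le (G m) (d m)" for m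
  proof (cases m)
    case 0
    then show ?thesis using L2le_diff[OF c uA[of 0]] by (simp add: G_def d_def)
  next
    case (Suc m')
    have "L2le (\<lambda>x. (u x - A m' x) - (u x - A (Suc m') x)) (sqrt 2 * w (2 ^ m') + sqrt 2 * w (2 ^ Suc m'))"
      by (rule L2le_diff[OF uA uA])
    moreover have "sqrt 2 * w (2 ^ m') + sqrt 2 * w (2 ^ Suc m') \<le> 3 * w (2 ^ m')"
    proof -
      have "w (2 ^ Suc m') \<le> w (2 ^ m')" by (rule lift_Suc_antimono_le[of w, OF anti]) simp
      then have "sqrt 2 * w (2 ^ m') + sqrt 2 * w (2 ^ Suc m') \<le> sqrt 2 * w (2 ^ m') + sqrt 2 * w (2 ^ m')"
        by simp
      also have "\<dots> = 2 * sqrt 2 * w (2 ^ m')" by simp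
      also have "\<dots> \<le> 3 * w (2 ^ m')"
      proof (rule mult_right_mono[OF _ w0])
        have "sqrt 2 \<le> 3 / 2" by (rule real_le_lsqrt) (simp_all add: power2_eq_square)
        then show "2 * sqrt 2 \<le> (3::real)" by simp
      qed
      finally show ?thesis .
    qed
    ultimately have "L2le (\<lambda>x. (u x - A m' x) - (u x - A (Suc m') x)) (3 * w (2 ^ m'))" by (rule L2le_weaken)
    then show ?thesis by (simp add: G_def d_def Suc)
  qed
  have G_sum: "(\<Sum>m\<le>p. G m x) = A p x" for p x
    by (induction p) (simp_all add: G_def)
  define f where "f m = w m / sqrt (real m)" for m
  have "summable f" using summ summable_Suc_iff[of f] by (simp add: f_def)
  moreover have "f (Suc m) \<le> f m" if "m > 0" for m
    unfolding f_def using anti w0 that by (intro frac_le) auto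
  moreover have "f m \<ge> 0" for m using w0 by (simp add: f_def)
  ultimately have cond: "summable (\<lambda>m. 2 ^ m * f (2 ^ m))" using condensation_test[of f] by blast
  have f_eq: "2 ^ m * f (2 ^ m) = sqrt (2 ^ m) * w (2 ^ m)" for m
  proof -
    have "(2::real) ^ m = sqrt (2 ^ m) * sqrt (2 ^ m)" by simp
    then show ?thesis by (simp add: f_def divide_simps)
  qed
  have d_summ: "summable (\<lambda>m. d m * sqrt (2 ^ m))"
  proof -
    have "summable (\<lambda>m. 3 * sqrt 2 * (2 ^ m * f (2 ^ m)))" using cond by (rule summable_mult)
    then have "summable (\<lambda>m. d (Suc m) * sqrt (2 ^ Suc m))"
      by (simp add: f_eq d_def real_sqrt_mult mult_ac)
    then show ?thesis by (subst (asm) summable_Suc_iff)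
  qed
  have d0: "d m \<ge> 0" for m using G_L2 by (rule L2le_nonneg)
  have w_lim: "(\<lambda>p. w (2 ^ p)) \<longlonglongrightarrow> 0"
  proof (rule tendsto_sandwich[of "\<lambda>_. 0" _ _ "\<lambda>p. 2 ^ p * f (2 ^ p)"])
    show "\<forall>\<^sub>F p in sequentially. w (2 ^ p) \<le> 2 ^ p * f (2 ^ p)"
    proof (rule always_eventually, rule allI)
      fix p
      have "1 * w (2 ^ p) \<le> sqrt (2 ^ p) * w (2 ^ p)" using w0 by (intro mult_right_mono) auto
      then show "w (2 ^ p) \<le> 2 ^ p * f (2 ^ p)" by (simp add: f_eq)
    qed
    show "(\<lambda>p. 2 ^ p * f (2 ^ p)) \<longlonglongrightarrow> 0" using cond by (rule summable_LIMSEQ_zero)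
  qed (use w0 in auto)
  define B where "B = 18 * sqrt (real D) * (\<Sum>m. d m * sqrt (2 ^ m))"
  have B0: "B \<ge> 0" unfolding B_def using d_summ d0 by (intro mult_nonneg_nonneg suminf_nonneg) auto
  have "\<exists>W. L2le W (B * sqrt (\<Sum>k<l. (a k)\<^sup>2) + \<eta>) \<and> (\<forall>x. \<forall>J\<le>l. \<bar>\<Sum>k<J. a k * u (real (n k) * x)\<bar> \<le> W x)"
    if \<eta>: "\<eta> > 0" for a :: "nat \<Rightarrow> real" and l \<eta>
  proof -
    let ?S = "sqrt (\<Sum>k<l. (a k)\<^sup>2)"
    have "\<exists>W. L2le W (18 * d m * sqrt (real (D * 2 ^ m)) * ?S) \<and>
       (\<forall>x. \<forall>J\<le>l. \<bar>\<Sum>k<J. a k * G m (real (n k) * x)\<bar> \<le> W x)" for m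
    proof -
      obtain C where C: "\<And>x. \<bar>G m x\<bar> \<le> C" using G_bd by blast
      show ?thesis
        by (rule maximal_inequality_step[where g = "G m" and M = "2 ^ m" and n = n,
              OF G_meas G_per G_step _ C G_mean G_L2 n q less_imp_le[OF D]]) simp
    qed
    then have "\<forall>m. \<exists>W. L2le W (18 * d m * sqrt (real (D * 2 ^ m)) * ?S) \<and>
       (\<forall>x. \<forall>J\<le>l. \<bar>\<Sum>k<J. a k * G m (real (n k) * x)\<bar> \<le> W x)" by (rule allI)
    from choice[OF this] obtain W where WL: "\<And>m. L2le (W m) (18 * d m * sqrt (real (D * 2 ^ m)) * ?S)"
      and Wx: "\<And>m x J. J \<le> l \<Longrightarrow> \<bar>\<Sum>k<J. a k * G m (real (n k) * x)\<bar> \<le> W m x" by blast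
    define K where "K = (\<Sum>k<l. \<bar>a k\<bar>) * sqrt 2"
    have K0: "K \<ge> 0" by (simp add: K_def sum_nonneg)
    have "(\<lambda>p. K * w (2 ^ p)) \<longlonglongrightarrow> K * 0" by (intro tendsto_mult tendsto_const w_lim)
    then have "\<forall>\<^sub>F p in sequentially. K * w (2 ^ p) < \<eta>" using \<eta> by (intro order_tendstoD(2)) auto
    then obtain p where p: "K * w (2 ^ p) < \<eta>" by (auto simp: eventually_sequentially)
    define V where "V x = (\<Sum>m\<le>p. W m x) + (\<Sum>k<l. \<bar>a k\<bar> * \<bar>u (real (n k) * x) - A p (real (n k) * x)\<bar>)" for x
    have "L2le (\<lambda>x. \<Sum>m\<le>p. W m x) (\<Sum>m\<le>p. 18 * d m * sqrt (real (D * 2 ^ m)) * ?S)"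
      by (intro L2le_sum WL) simp
    moreover have "(\<Sum>m\<le>p. 18 * d m * sqrt (real (D * 2 ^ m)) * ?S) \<le> B * ?S"
    proof -
      have "(\<Sum>m\<le>p. 18 * d m * sqrt (real (D * 2 ^ m)) * ?S) = 18 * sqrt (real D) * (\<Sum>m\<le>p. d m * sqrt (2 ^ m)) * ?S"
        by (simp add: sum_distrib_left sum_distrib_right real_sqrt_mult mult_ac)
      also have "\<dots> \<le> B * ?S" unfolding B_def using d0 d_summ
        by (intro mult_right_mono mult_left_mono sum_le_suminf) (auto simp: sum_nonneg)
      finally show ?thesis .
    qed
    ultimately have 1: "L2le (\<lambda>x. \<Sum>m\<le>p. W m x) (B * ?S)" by (rule L2le_weaken)
    have "L2le (\<lambda>x. \<Sum>k<l. \<bar>a k\<bar> * \<bar>u (real (n k) * x) - A p (real (n k) * x)\<bar>) (\<Sum>k<l. \<bar>\<bar>a k\<bar>\<bar> * (sqrt 2 * w (2 ^ p)))"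
    proof (intro L2le_sum L2le_scale L2le_abs)
      fix k
      show "L2le (\<lambda>x. u (real (n k) * x) - A p (real (n k) * x)) (sqrt 2 * w (2 ^ p))"
        using L2le_dilation[OF uA, of p "n k"] n(1) by (simp add: per A_per)
    qed simp
    moreover have "(\<Sum>k<l. \<bar>\<bar>a k\<bar>\<bar> * (sqrt 2 * w (2 ^ p))) \<le> \<eta>"
      using p by (simp add: K_def sum_distrib_right mult.assoc)
    ultimately have "L2le (\<lambda>x. \<Sum>k<l. \<bar>a k\<bar> * \<bar>u (real (n k) * x) - A p (real (n k) * x)\<bar>) \<eta>" by (rule L2le_weaken)
    from L2le_add[OF 1 this] have VL: "L2le V (B * ?S + \<eta>)" by (simp add: V_def[abs_def])
    have "\<bar>\<Sum>k<J. a k * u (real (n k) * x)\<bar> \<le> V x" if J: "J \<le> l" for J x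
    proof -
      have "(\<Sum>k<J. a k * u (real (n k) * x)) = (\<Sum>k<J. a k * A p (real (n k) * x)) + (\<Sum>k<J. a k * (u (real (n k) * x) - A p (real (n k) * x)))"
        by (simp add: algebra_simps flip: sum.distrib)
      also have "(\<Sum>k<J. a k * A p (real (n k) * x)) = (\<Sum>m\<le>p. \<Sum>k<J. a k * G m (real (n k) * x))"
        unfolding G_sum[symmetric] sum_distrib_left by (rule sum.swap)
      finally have "\<bar>\<Sum>k<J. a k * u (real (n k) * x)\<bar> \<le> \<bar>\<Sum>m\<le>p. \<Sum>k<J. a k * G m (real (n k) * x)\<bar>
         + \<bar>\<Sum>k<J. a k * (u (real (n k) * x) - A p (real (n k) * x))\<bar>" by linarith
      also have "\<bar>\<Sum>m\<le>p. \<Sum>k<J. a k * G m (real (n k) * x)\<bar> \<le> (\<Sum>m\<le>p. W m x)"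
        by (rule order_trans[OF sum_abs], rule sum_mono) (use Wx[OF J] in auto)
      also have "\<bar>\<Sum>k<J. a k * (u (real (n k) * x) - A p (real (n k) * x))\<bar> \<le> (\<Sum>k<J. \<bar>a k\<bar> * \<bar>u (real (n k) * x) - A p (real (n k) * x)\<bar>)"
        by (rule order_trans[OF sum_abs]) (simp add: abs_mult)
      also have "\<dots> \<le> (\<Sum>k<l. \<bar>a k\<bar> * \<bar>u (real (n k) * x) - A p (real (n k) * x)\<bar>)"
        using J by (intro sum_mono2) auto
      finally show ?thesis by (simp add: V_def)
    qed
    with VL show ?thesis by blast
  qed
  with B0 show ?thesis by blast
qed

section \<open>Almost everywhere convergence\<close>

text \<open>
  Applied to the coefficients from index \<open>K\<close> on, the maximal inequality shows that the supremum of the partial sums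
  of the tail has norm at most \<open>\<epsilon> K\<close>, which tends to zero. Hence the infimum over \<open>K\<close> of these suprema
  vanishes almost everywhere, which is the Cauchy criterion.
\<close>

lemma AE_summable_of_maximal_inequality:
  fixes \<phi> :: "nat \<Rightarrow> real \<Rightarrow> real" and a :: "nat \<Rightarrow> real"
  assumes meas [measurable]: "\<And>k. \<phi> k \<in> borel_measurable borel" and B: "B \<ge> 0"
    and max: "\<And>(a :: nat \<Rightarrow> real) l \<eta>. \<eta> > 0 \<Longrightarrow> \<exists>W. L2le W (B * sqrt (\<Sum>k<l. (a k)\<^sup>2) + \<eta>) \<and>
       (\<forall>x. \<forall>J\<le>l. \<bar>\<Sum>k<J. a k * \<phi> k x\<bar> \<le> W x)"
    and a: "summable (\<lambda>k. (a k)\<^sup>2)"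
  shows "AE x in circle. summable (\<lambda>k. a k * \<phi> k x)"
proof -
  define s where "s K J x = (\<Sum>k<J. (if K \<le> k then a k else 0) * \<phi> k x)" for K J x
  define e where "e K J x = ennreal ((s K J x)\<^sup>2)" for K J x
  define T where "T K x = (SUP J. e K J x)" for K x
  define \<tau> where "\<tau> K = (\<Sum>k. (a (k + K))\<^sup>2)" for K
  have s_meas [measurable]: "s K J \<in> borel_measurable borel" for K J unfolding s_def by measurable
  have e_meas [measurable]: "e K J \<in> borel_measurable borel" for K J unfolding e_def by measurable
  have T_meas [measurable]: "T K \<in> borel_measurable borel" for K unfolding T_def by measurable
  have tail: "(\<Sum>k<l. (if K \<le> k then a k else 0)\<^sup>2) \<le> \<tau> K" for K l
  proof -
    have "(\<Sum>k<l. (if K \<le> k then a k else 0)\<^sup>2) = (\<Sum>k\<in>{K..<l}. (a k)\<^sup>2)"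
      by (rule sum.mono_neutral_cong_right) auto
    also have "\<dots> \<le> (\<Sum>k\<in>{0 + K..<l + K}. (a k)\<^sup>2)" by (rule sum_mono2) auto
    also have "\<dots> = (\<Sum>k<l. (a (k + K))\<^sup>2)"
      by (subst sum.shift_bounds_nat_ivl) (simp add: atLeast0LessThan)
    also have "\<dots> \<le> \<tau> K" unfolding \<tau>_def
      using a summable_iff_shift[of "\<lambda>k. (a k)\<^sup>2" K] by (intro sum_le_suminf) auto
    finally show ?thesis .
  qed
  define \<epsilon> where "\<epsilon> K = B * sqrt (\<tau> K) + 1 / real (Suc K)" for K
  have T_int: "(\<integral>\<^sup>+x. T K x \<partial>circle) \<le> ennreal ((\<epsilon> K)\<^sup>2)" for K
  proof -
    \<comment> \<open>Only finitely many partial sums are dominated at once; monotone convergence gives the supremum of all.\<close>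
    define t where "t l x = (SUP J\<in>{..l}. e K J x)" for l x
    have t_meas [measurable]: "t l \<in> borel_measurable borel" for l unfolding t_def by measurable
    have "(\<integral>\<^sup>+x. T K x \<partial>circle) = (\<integral>\<^sup>+x. (SUP l. t l x) \<partial>circle)"
    proof (rule nn_integral_cong)
      fix x
      show "T K x = (SUP l. t l x)"
      proof (rule antisym)
        show "T K x \<le> (SUP l. t l x)" unfolding T_def
        proof (rule SUP_least)
          fix J
          have "e K J x \<le> t J x" unfolding t_def by (rule SUP_upper) simp
          also have "\<dots> \<le> (SUP l. t l x)" by (rule SUP_upper) simp
          finally show "e K J x \<le> (SUP l. t l x)" .
        qed
        show "(SUP l. t l x) \<le> T K x" unfolding T_def t_def
          by (intro SUP_least) (auto intro!: SUP_upper)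
      qed
    qed
    also have "\<dots> = (SUP l. \<integral>\<^sup>+x. t l x \<partial>circle)"
    proof (rule nn_integral_monotone_convergence_SUP)
      show "incseq t" unfolding t_def by (auto simp: incseq_def le_fun_def intro!: SUP_subset_mono)
    qed (rule measurable_circle, rule t_meas)
    also have "\<dots> \<le> ennreal ((\<epsilon> K)\<^sup>2)"
    proof (rule SUP_least)
      fix l
      have "1 / real (Suc K) > 0" by simp
      from max[OF this, of "\<lambda>k. if K \<le> k then a k else 0" l] obtain W where
        WL: "L2le W (B * sqrt (\<Sum>k<l. (if K \<le> k then a k else 0)\<^sup>2) + 1 / real (Suc K))"
        and Wx: "\<And>x J. J \<le> l \<Longrightarrow> \<bar>s K J x\<bar> \<le> W x" unfolding s_def by blast
      have "L2le W (\<epsilon> K)" unfolding \<epsilon>_def using B tail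
        by (intro L2le_weaken[OF WL] add_mono mult_left_mono real_sqrt_le_mono) auto
      then have "(\<integral>\<^sup>+x. ennreal ((W x)\<^sup>2) \<partial>circle) \<le> ennreal ((\<epsilon> K)\<^sup>2)" by (simp add: L2le_def)
      moreover have "t l x \<le> ennreal ((W x)\<^sup>2)" for x
        unfolding t_def e_def
      proof (rule SUP_least)
        fix J assume "J \<in> {..l}"
        then have "\<bar>s K J x\<bar> \<le> \<bar>W x\<bar>" using Wx[of J x] by simp
        then show "ennreal ((s K J x)\<^sup>2) \<le> ennreal ((W x)\<^sup>2)" by (intro ennreal_leI) (simp add: abs_le_square_iff)
      qed
      then have "(\<integral>\<^sup>+x. t l x \<partial>circle) \<le> (\<integral>\<^sup>+x. ennreal ((W x)\<^sup>2) \<partial>circle)" by (intro nn_integral_mono)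
      ultimately show "(\<integral>\<^sup>+x. t l x \<partial>circle) \<le> ennreal ((\<epsilon> K)\<^sup>2)" by (rule order_trans[rotated])
    qed
    finally show ?thesis .
  qed
  have "\<tau> \<longlonglongrightarrow> 0" unfolding \<tau>_def using suminf_exist_split2[OF a] by simp
  then have "(\<lambda>K. sqrt (\<tau> K)) \<longlonglongrightarrow> 0" using tendsto_real_sqrt by fastforce
  then have "\<epsilon> \<longlonglongrightarrow> B * 0 + 0" unfolding \<epsilon>_def using LIMSEQ_Suc[OF lim_inverse_n']
    by (intro tendsto_add tendsto_mult tendsto_const) auto
  then have "(\<lambda>K. (\<epsilon> K)\<^sup>2) \<longlonglongrightarrow> 0" using tendsto_power[of \<epsilon> 0 sequentially 2] by simp
  then have lim: "(\<lambda>K. ennreal ((\<epsilon> K)\<^sup>2)) \<longlonglongrightarrow> 0" using tendsto_ennrealI by fastforce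
  have "(\<integral>\<^sup>+x. (INF K. T K x) \<partial>circle) \<le> ennreal ((\<epsilon> K)\<^sup>2)" for K
    using T_int[of K] by (rule order_trans[rotated]) (intro nn_integral_mono INF_lower, simp)
  then have "(\<integral>\<^sup>+x. (INF K. T K x) \<partial>circle) \<le> 0" using lim by (intro LIMSEQ_le_const[OF lim]) auto
  then have "(\<integral>\<^sup>+x. (INF K. T K x) \<partial>circle) = 0" by simp
  moreover have "(\<lambda>x. INF K. T K x) \<in> borel_measurable circle" by (rule measurable_circle) measurable
  ultimately have "AE x in circle. (INF K. T K x) = 0" by (simp add: nn_integral_0_iff_AE)
  then show ?thesis
  proof (rule AE_mp, intro AE_I2 impI)
    fix x assume x: "(INF K. T K x) = 0"
    show "summable (\<lambda>k. a k * \<phi> k x)"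
      unfolding summable_Cauchy
    proof (intro allI impI)
      fix r :: real assume r: "r > 0"
      have "(INF K. T K x) < ennreal ((r / 2)\<^sup>2)" unfolding x using r by simp
      then obtain K where K: "T K x < ennreal ((r / 2)\<^sup>2)" by (auto simp: INF_less_iff)
      have sK: "\<bar>s K J x\<bar> < r / 2" for J
      proof -
        have "e K J x \<le> T K x" unfolding T_def by (rule SUP_upper) simp
        then have "ennreal ((s K J x)\<^sup>2) < ennreal ((r / 2)\<^sup>2)" using K by (simp add: e_def)
        then have "(s K J x)\<^sup>2 < (r / 2)\<^sup>2" by (simp add: ennreal_less_iff)
        then show ?thesis using r power2_less_imp_less[of "\<bar>s K J x\<bar>" "r / 2"] by simp
      qed
      show "\<exists>K. \<forall>m\<ge>K. \<forall>J. norm (\<Sum>k = m..<J. a k * \<phi> k x) < r"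
      proof (intro exI allI impI)
        fix m J assume m: "m \<ge> K"
        show "norm (\<Sum>k = m..<J. a k * \<phi> k x) < r"
        proof (cases "m \<le> J")
          case True
          have "s K J x = s K m x + (\<Sum>k = m..<J. (if K \<le> k then a k else 0) * \<phi> k x)"
            unfolding s_def lessThan_atLeast0 using True by (subst sum.atLeastLessThan_concat) auto
          also have "(\<Sum>k = m..<J. (if K \<le> k then a k else 0) * \<phi> k x) = (\<Sum>k = m..<J. a k * \<phi> k x)"
            using m by (intro sum.cong) auto
          finally have "(\<Sum>k = m..<J. a k * \<phi> k x) = s K J x - s K m x" by simp
          then show ?thesis using sK[of J] sK[of m] by simp
        qed (use r in simp)
      qed
    qed
  qed
qed

section \<open>Borel representatives and the passage to Lebesgue measure\<close>

lemma AE_lebesgue_iff_negligible: "(AE x in lebesgue. P x) \<longleftrightarrow> negligible {x. \<not> P x}"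
proof
  assume "AE x in lebesgue. P x"
  then obtain N where "N \<in> null_sets lebesgue" "{x. \<not> P x} \<subseteq> N"
    unfolding eventually_ae_filter by auto
  then show "negligible {x. \<not> P x}" using negligible_iff_null_sets negligible_subset by blast
next
  assume "negligible {x. \<not> P x}"
  then show "AE x in lebesgue. P x" by (intro AE_I'[of "{x. \<not> P x}"]) (auto simp: negligible_iff_null_sets)
qed

lemma negligible_shift_preimage:
  fixes N :: "real set"
  assumes "negligible N" shows "negligible {x. x + h \<in> N}"
proof -
  have "{x. x + h \<in> N} \<subseteq> (+) (- h) ` N"
  proof
    fix x assume "x \<in> {x. x + h \<in> N}"
    then have "x + h \<in> N" "x = - h + (x + h)" by auto
    then show "x \<in> (+) (- h) ` N" by blast
  qed
  then show ?thesis using negligible_translation[OF assms] negligible_subset by blast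
qed

lemma negligible_dilation_preimage:
  fixes N :: "real set"
  assumes "negligible N" "c \<noteq> 0" shows "negligible {x. c * x \<in> N}"
proof -
  have "{x. c * x \<in> N} \<subseteq> (\<lambda>y. y * inverse c) ` N"
  proof
    fix x assume "x \<in> {x. c * x \<in> N}"
    then have "c * x \<in> N" "x = (c * x) * inverse c" using assms(2) by auto
    then show "x \<in> (\<lambda>y. y * inverse c) ` N" by blast
  qed
  moreover have "negligible ((\<lambda>y. y * inverse c) ` N)"
    by (rule negligible_differentiable_image_negligible[OF _ assms(1)])
       (auto intro!: derivative_intros simp: differentiable_on_def)
  ultimately show ?thesis using negligible_subset by blast
qed

lemma negligible_frac_preimage:
  fixes N :: "real set"
  assumes "negligible N" shows "negligible {x. frac x \<in> N}"
proof -
  have "{x. frac x \<in> N} \<subseteq> (\<Union>z::int. {x. x + of_int z \<in> N})"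
  proof
    fix x assume "x \<in> {x. frac x \<in> N}"
    then have "x + of_int (- \<lfloor>x\<rfloor>) \<in> N" by (simp add: frac_def)
    then show "x \<in> (\<Union>z::int. {x. x + of_int z \<in> N})" by blast
  qed
  moreover have "negligible (\<Union>z::int. {x. x + of_int z \<in> N})"
    using negligible_shift_preimage[OF assms] by (intro negligible_countable_Union) auto
  ultimately show ?thesis using negligible_subset by blast
qed

text \<open>
  A periodic exceptional set consists of countably many translates of its part in one period.
\<close>

lemma AE_circle_imp_AE_lebesgue:
  assumes "AE x in circle. P x" "\<And>x. P (x + 1) = P x"
  shows "AE x in lebesgue. P x"
proof -
  have "AE x in lborel. x \<in> {0..<1} \<longrightarrow> P x"
    using assms(1) unfolding circle_def by (subst (asm) AE_restrict_space_iff) auto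
  then have "AE x in lebesgue. x \<in> {0..<1} \<longrightarrow> P x" by (rule AE_completion)
  then have "negligible {x. frac x \<in> {x. \<not> (x \<in> {0..<1} \<longrightarrow> P x)}}"
    unfolding AE_lebesgue_iff_negligible by (rule negligible_frac_preimage)
  moreover have "{x. \<not> P x} \<subseteq> {x. frac x \<in> {x. \<not> (x \<in> {0..<1} \<longrightarrow> P x)}}"
  proof
    fix x assume "x \<in> {x. \<not> P x}"
    moreover have "P (frac x) = P x" using periodic_add_int[of P x "- \<lfloor>x\<rfloor>"] assms(2) by (simp add: frac_def)
    ultimately show "x \<in> {x. frac x \<in> {x. \<not> (x \<in> {0..<1} \<longrightarrow> P x)}}" by (simp add: frac_lt_1)
  qed
  ultimately show ?thesis unfolding AE_lebesgue_iff_negligible using negligible_subset by blast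
qed

text \<open>
  The endpoint 1 is a null set, and for Borel functions the completion changes neither integrability nor the integral.
\<close>

lemma circle_transfer:
  fixes F p :: "real \<Rightarrow> 'b::{banach, second_countable_topology}"
  assumes F [measurable]: "F \<in> borel_measurable lebesgue" and p [measurable]: "p \<in> borel_measurable borel"
    and eq: "AE x in lebesgue. F x = p x"
  shows "set_integrable lebesgue {0..1} F \<longleftrightarrow> integrable circle p"
    and "(LINT x:{0..1}|lebesgue. F x) = (LINT x|circle. p x)"
proof -
  have pm: "(\<lambda>x. indicator {0..<1} x *\<^sub>R p x) \<in> borel_measurable lborel"
    using borel_measurable_scaleR[OF borel_measurable_indicator p, of "{0..<1}"] by simp
  have pm': "(\<lambda>x. indicator {0..<1} x *\<^sub>R p x) \<in> borel_measurable lebesgue" using pm by (rule measurable_completion)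
  have Fm: "(\<lambda>x. indicator {0..1} x *\<^sub>R F x) \<in> borel_measurable lebesgue"
    using borel_measurable_scaleR[OF borel_measurable_indicator F, of "{0..1}"] by simp
  have "AE x in lebesgue. x \<noteq> (1::real)"
    unfolding AE_lebesgue_iff_negligible by simp
  with eq have ae: "AE x in lebesgue. indicator {0..1} x *\<^sub>R F x = indicator {0..<1} x *\<^sub>R p x"
    by eventually_elim (auto simp: indicator_def)
  show "set_integrable lebesgue {0..1} F \<longleftrightarrow> integrable circle p"
    unfolding set_integrable_def integrable_cong_AE[OF Fm pm' ae] integrable_completion[OF pm]
    by (simp add: circle_def integrable_restrict_space)
  show "(LINT x:{0..1}|lebesgue. F x) = (LINT x|circle. p x)"
    unfolding set_lebesgue_integral_def integral_cong_AE[OF Fm pm' ae] integral_completion[OF pm]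
    by (simp add: circle_def integral_restrict_space)
qed

lemma L2_norm_circle_eq:
  fixes p r :: "real \<Rightarrow> real"
  assumes [measurable]: "F \<in> borel_measurable lebesgue" "p \<in> borel_measurable borel" "r \<in> borel_measurable borel"
    and eq: "AE x in lebesgue. F x = Complex (p x) (r x)"
  shows "set_integrable lebesgue {0..1} (\<lambda>x. (cmod (F x))\<^sup>2) \<longleftrightarrow> integrable circle (\<lambda>x. (p x)\<^sup>2 + (r x)\<^sup>2)"
    and "L2_norm_circle F = sqrt (LINT x|circle. (p x)\<^sup>2 + (r x)\<^sup>2)"
proof -
  have "AE x in lebesgue. (cmod (F x))\<^sup>2 = (p x)\<^sup>2 + (r x)\<^sup>2"
    using eq by eventually_elim (simp add: cmod_power2)
  note * = circle_transfer[OF _ _ this]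
  show "set_integrable lebesgue {0..1} (\<lambda>x. (cmod (F x))\<^sup>2) \<longleftrightarrow> integrable circle (\<lambda>x. (p x)\<^sup>2 + (r x)\<^sup>2)"
    by (rule *(1)) measurable
  have "(LINT x:{0..1}|lebesgue. (cmod (F x))\<^sup>2) = (LINT x|circle. (p x)\<^sup>2 + (r x)\<^sup>2)"
    by (rule *(2)) measurable
  then show "L2_norm_circle F = sqrt (LINT x|circle. (p x)\<^sup>2 + (r x)\<^sup>2)" by (simp add: L2_norm_circle_def)
qed

lemma L2le_left_summand:
  assumes [measurable]: "p \<in> borel_measurable borel" "r \<in> borel_measurable borel"
    and int: "integrable circle (\<lambda>x. (p x)\<^sup>2 + (r x)\<^sup>2)"
  shows "L2le p (sqrt (LINT x|circle. (p x)\<^sup>2 + (r x)\<^sup>2))"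
proof (rule L2leI)
  show i: "integrable circle (\<lambda>x. (p x)\<^sup>2)"
    by (rule Bochner_Integration.integrable_bound[OF int]) auto
  have "(LINT x|circle. (p x)\<^sup>2) \<le> (LINT x|circle. (p x)\<^sup>2 + (r x)\<^sup>2)"
    using i int by (intro integral_mono) auto
  moreover have "0 \<le> (LINT x|circle. (p x)\<^sup>2 + (r x)\<^sup>2)" by simp
  ultimately show "(LINT x|circle. (p x)\<^sup>2) \<le> (sqrt (LINT x|circle. (p x)\<^sup>2 + (r x)\<^sup>2))\<^sup>2" by simp
qed auto

lemma L2le_right_summand:
  assumes "p \<in> borel_measurable borel" "r \<in> borel_measurable borel"
    and "integrable circle (\<lambda>x. (p x)\<^sup>2 + (r x)\<^sup>2)"
  shows "L2le r (sqrt (LINT x|circle. (p x)\<^sup>2 + (r x)\<^sup>2))"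
  using L2le_left_summand[of r p] assms by (simp add: add.commute)

text \<open>
  The use of Fubini requires Borel functions, and a Borel function that is almost everywhere equal to a periodic one
  need not be periodic. Evaluating it at the fractional part repairs this.
\<close>

lemma borel_periodic_representative:
  fixes v :: "real \<Rightarrow> real"
  assumes v: "v \<in> borel_measurable lebesgue" and per: "\<And>x. v (x + 1) = v x"
  obtains u where "u \<in> borel_measurable borel" "\<And>x. u (x + 1) = u x" "AE x in lebesgue. v x = u x"
proof -
  obtain u0 where u0: "u0 \<in> borel_measurable lborel" "AE x in lborel. v x = u0 x"
    using completion_ex_borel_measurable_real[OF v] by blast
  have [measurable]: "u0 \<in> borel_measurable borel" using u0(1) by simp
  have "AE x in lebesgue. v x = u0 x" using u0(2) by (rule AE_completion)
  then have "negligible {x. frac x \<in> {x. \<not> v x = u0 x}}"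
    unfolding AE_lebesgue_iff_negligible by (rule negligible_frac_preimage)
  moreover have "v (frac x) = v x" for x
    using periodic_add_int[of v x "- \<lfloor>x\<rfloor>"] per by (simp add: frac_def)
  ultimately have "AE x in lebesgue. v x = u0 (frac x)" unfolding AE_lebesgue_iff_negligible by simp
  moreover have "(\<lambda>x. u0 (frac x)) \<in> borel_measurable borel" by measurable
  moreover have "u0 (frac (x + 1)) = u0 (frac x)" for x by (simp add: frac_def)
  ultimately show ?thesis by (intro that[of "\<lambda>x. u0 (frac x)"])
qed

section \<open>The convergence theorem\<close>

lemma real_convergence:
  fixes n :: "nat \<Rightarrow> nat" and u :: "real \<Rightarrow> real" and w :: "nat \<Rightarrow> real" and a :: "nat \<Rightarrow> real"
  assumes u [measurable]: "u \<in> borel_measurable borel" and per: "\<And>x. u (x + 1) = u x"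
    and c: "L2le u c" and mean: "(LINT x|circle. u x) = 0"
    and \<omega>: "\<And>L h. 0 \<le> h \<Longrightarrow> h \<le> (1/2) ^ L \<Longrightarrow> L2le (\<lambda>x. u (x + h) - u x) (w L)"
    and anti: "\<And>L. w (Suc L) \<le> w L"
    and summ: "summable (\<lambda>m. w (Suc m) / sqrt (real (Suc m)))"
    and n: "\<And>k. n k > 0" "\<And>k. real (n (Suc k)) \<ge> q * real (n k)" and q: "q > 1"
    and a: "summable (\<lambda>k. (a k)\<^sup>2)"
  shows "AE x in lebesgue. summable (\<lambda>k. a k * u (real (n k) * x))"
proof (rule AE_circle_imp_AE_lebesgue)
  obtain B where B: "B \<ge> 0" and max: "\<forall>(a :: nat \<Rightarrow> real) l \<eta>. \<eta> > 0 \<longrightarrow> (\<exists>W. L2le W (B * sqrt (\<Sum>k<l. (a k)\<^sup>2) + \<eta>) \<and>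
       (\<forall>x. \<forall>J\<le>l. \<bar>\<Sum>k<J. a k * u (real (n k) * x)\<bar> \<le> W x))"
    using maximal_inequality_modulus[where u = u and w = w and n = n, OF u per c mean \<omega> anti summ n q] by blast
  show "AE x in circle. summable (\<lambda>k. a k * u (real (n k) * x))"
  proof (rule AE_summable_of_maximal_inequality[where \<phi> = "\<lambda>k x. u (real (n k) * x)", OF _ B _ a])
    show "(\<lambda>x. u (real (n k) * x)) \<in> borel_measurable borel" for k by measurable
  qed (use max in blast)
  show "summable (\<lambda>k. a k * u (real (n k) * (x + 1))) = summable (\<lambda>k. a k * u (real (n k) * x))" for x
    by (simp only: periodic_mult_nat[of u, OF per])
qed

text \<open>
  Real and imaginary parts are treated separately, each with the modulus of continuity of \<open>f\<close> as a common bound, and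
  so are the real and imaginary parts of the coefficients.
\<close>

theorem theoremC:
  fixes f :: "real \<Rightarrow> complex" and n :: "nat \<Rightarrow> nat"
  assumes "f \<in> L2_circle"
    and "(LINT x:{0..1}|lebesgue. f x) = 0"
    and "summable (\<lambda>m::nat. L2_modulus ((1/2) ^ Suc m) f / sqrt (real (Suc m)))"
    and "hadamard_lacunary n"
  shows "convergence_system (\<lambda>k x. f (real (n k) * x))"
proof -
  have f [measurable]: "f \<in> borel_measurable lebesgue" and per: "\<And>x. f (x + 1) = f x"
    and f2: "set_integrable lebesgue {0..1} (\<lambda>x. (cmod (f x))\<^sup>2)"
    using assms(1) by (auto simp: L2_circle_def)
  have npos: "\<And>k. n k > 0" using assms(4) by (simp add: hadamard_lacunary_def)
  obtain q where q: "q > 1" and qn: "q \<le> (INF k. real (n (Suc k)) / real (n k))"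
    using assms(4) by (auto simp: hadamard_lacunary_def)
  have nq: "real (n (Suc k)) \<ge> q * real (n k)" for k
  proof -
    have "bdd_below (range (\<lambda>k. real (n (Suc k)) / real (n k)))" by (rule bdd_belowI2[of _ 0]) simp
    then have "(INF k. real (n (Suc k)) / real (n k)) \<le> real (n (Suc k)) / real (n k)" by (rule cINF_lower) simp
    with qn have "q \<le> real (n (Suc k)) / real (n k)" by linarith
    then show ?thesis using npos[of k] by (simp add: pos_le_divide_eq)
  qed
  obtain u where u [measurable]: "u \<in> borel_measurable borel" and u_per: "\<And>x. u (x + 1) = u x"
    and u_eq: "AE x in lebesgue. Re (f x) = u x"
    by (rule borel_periodic_representative[of "\<lambda>x. Re (f x)"]) (use per in auto)
  obtain v where v [measurable]: "v \<in> borel_measurable borel" and v_per: "\<And>x. v (x + 1) = v x"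
    and v_eq: "AE x in lebesgue. Im (f x) = v x"
    by (rule borel_periodic_representative[of "\<lambda>x. Im (f x)"]) (use per in auto)
  have eq: "AE x in lebesgue. f x = Complex (u x) (v x)"
    using u_eq v_eq by eventually_elim (simp add: complex_eq_iff)
  define Z where "Z = {x. \<not> f x = Complex (u x) (v x)}"
  have Z: "negligible Z" using eq by (simp add: AE_lebesgue_iff_negligible Z_def)
  define c where "c = sqrt (LINT x|circle. (u x)\<^sup>2 + (v x)\<^sup>2)"
  have uv_int: "integrable circle (\<lambda>x. (u x)\<^sup>2 + (v x)\<^sup>2)"
    using L2_norm_circle_eq(1)[OF f u v eq] f2 by simp
  have uc: "L2le u c" unfolding c_def by (rule L2le_left_summand[OF u v uv_int])
  have vc: "L2le v c" unfolding c_def by (rule L2le_right_summand[OF u v uv_int])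
  have mean: "(LINT x|circle. u x) = 0" "(LINT x|circle. v x) = 0"
  proof -
    have i: "integrable circle u" "integrable circle v" using uc vc L2le_integrable by auto
    have "AE x in lebesgue. f x = complex_of_real (u x) + \<i> * complex_of_real (v x)"
      using eq by eventually_elim (simp add: Complex_eq)
    then have "(LINT x:{0..1}|lebesgue. f x) = (LINT x|circle. complex_of_real (u x) + \<i> * complex_of_real (v x))"
      by (intro circle_transfer(2)) measurable
    also have "\<dots> = complex_of_real (LINT x|circle. u x) + \<i> * complex_of_real (LINT x|circle. v x)"
      using i by simp
    finally have "complex_of_real (LINT x|circle. u x) + \<i> * complex_of_real (LINT x|circle. v x) = 0"
      using assms(2) by simp
    then show "(LINT x|circle. u x) = 0" "(LINT x|circle. v x) = 0" by (simp_all add: complex_eq_iff)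
  qed
  define w where "w L = L2_modulus ((1/2) ^ L) f" for L :: nat
  have shift_eq: "AE x in lebesgue. f (x + h) - f x = Complex (u (x + h) - u x) (v (x + h) - v x)" for h
  proof -
    have "AE x in lebesgue. f (x + h) = Complex (u (x + h)) (v (x + h))"
      using negligible_shift_preimage[OF Z, of h] by (simp add: AE_lebesgue_iff_negligible Z_def)
    with eq show ?thesis by eventually_elim (simp add: complex_eq_iff)
  qed
  have shift_meas: "(\<lambda>x. f (x + h) - f x) \<in> borel_measurable lebesgue" for h
  proof -
    have "(\<lambda>x. h + x) \<in> lebesgue \<rightarrow>\<^sub>M lebesgue"
      using lebesgue_affine_measurable[of "\<lambda>_. 1" h] by simp
    from measurable_compose[OF this f] have "(\<lambda>x. f (x + h)) \<in> borel_measurable lebesgue" by (simp add: add.commute)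
    then show ?thesis by measurable
  qed
  have dm: "(\<lambda>x. u (x + h) - u x) \<in> borel_measurable borel" "(\<lambda>x. v (x + h) - v x) \<in> borel_measurable borel" for h
    by measurable
  have du: "L2le (\<lambda>x. u (x + h) - u x) (c + c)" and dv: "L2le (\<lambda>x. v (x + h) - v x) (c + c)" if "\<bar>h\<bar> \<le> 1" for h
    using L2le_diff[OF L2le_shift[OF uc u_per that] uc] L2le_diff[OF L2le_shift[OF vc v_per that] vc] .
  have d_int: "integrable circle (\<lambda>x. (u (x + h) - u x)\<^sup>2 + (v (x + h) - v x)\<^sup>2)" if "\<bar>h\<bar> \<le> 1" for h
    using L2le_integrable_square[OF du[OF that]] L2le_integrable_square[OF dv[OF that]] by simp
  note d_norm = L2_norm_circle_eq(2)[OF shift_meas dm shift_eq]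
  \<comment> \<open>Boundedness is needed for the real supremum in the modulus of continuity to be an upper bound.\<close>
  have bdd: "bdd_above ((\<lambda>h. L2_norm_circle (\<lambda>x. f (x + h) - f x)) ` {0..(1/2) ^ L})" for L
  proof (rule bdd_aboveI2)
    fix h :: real assume "h \<in> {0..(1/2) ^ L}"
    moreover have "(1/2::real) ^ L \<le> 1" by (simp add: power_le_one)
    ultimately have h: "\<bar>h\<bar> \<le> 1" by auto
    have "(LINT x|circle. (u (x + h) - u x)\<^sup>2 + (v (x + h) - v x)\<^sup>2) \<le> (c + c)\<^sup>2 + (c + c)\<^sup>2"
      using L2le_integrable_square[OF du[OF h]] L2le_integrable_square[OF dv[OF h]]
        L2le_integral_square[OF du[OF h]] L2le_integral_square[OF dv[OF h]] by simp
    then show "L2_norm_circle (\<lambda>x. f (x + h) - f x) \<le> sqrt ((c + c)\<^sup>2 + (c + c)\<^sup>2)"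
      unfolding d_norm by (rule real_sqrt_le_mono)
  qed
  have le_w: "L2_norm_circle (\<lambda>x. f (x + h) - f x) \<le> w L" if "0 \<le> h" "h \<le> (1/2) ^ L" for h L
    unfolding w_def L2_modulus_def using that by (intro cSUP_upper bdd) auto
  have h1: "\<bar>h\<bar> \<le> 1" if "0 \<le> h" "h \<le> (1/2) ^ L" for h :: real and L :: nat
  proof -
    have "(1/2::real) ^ L \<le> 1" by (simp add: power_le_one)
    with that show ?thesis by linarith
  qed
  have wu: "L2le (\<lambda>x. u (x + h) - u x) (w L)" if h: "0 \<le> h" "h \<le> (1/2) ^ L" for h L
    using L2le_left_summand[OF dm d_int[OF h1[OF h]]] le_w[OF h] unfolding d_norm by (rule L2le_weaken)
  have wv: "L2le (\<lambda>x. v (x + h) - v x) (w L)" if h: "0 \<le> h" "h \<le> (1/2) ^ L" for h L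
    using L2le_right_summand[OF dm d_int[OF h1[OF h]]] le_w[OF h] unfolding d_norm by (rule L2le_weaken)
  have anti: "w (Suc L) \<le> w L" for L
    unfolding w_def L2_modulus_def
  proof (rule cSUP_subset_mono[OF _ bdd])
    show "{0..(1/2::real) ^ Suc L} \<subseteq> {0..(1/2) ^ L}" by (auto intro: order_trans[OF _ power_decreasing])
  qed auto
  have summ: "summable (\<lambda>m. w (Suc m) / sqrt (real (Suc m)))" using assms(3) by (simp only: w_def)
  have conv_u: "AE x in lebesgue. summable (\<lambda>k. b k * u (real (n k) * x))"
    if "summable (\<lambda>k. (b k)\<^sup>2)" for b :: "nat \<Rightarrow> real"
    by (rule real_convergence[where u = u and w = w and n = n,
          OF u u_per uc mean(1) _ anti summ npos nq q that]) (rule wu)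
  have conv_v: "AE x in lebesgue. summable (\<lambda>k. b k * v (real (n k) * x))"
    if "summable (\<lambda>k. (b k)\<^sup>2)" for b :: "nat \<Rightarrow> real"
    by (rule real_convergence[where u = v and w = w and n = n,
          OF v v_per vc mean(2) _ anti summ npos nq q that]) (rule wv)
  \<comment> \<open>Dilations preserve null sets, so one exceptional set serves all dilations.\<close>
  have dil: "AE x in lebesgue. \<forall>k. f (real (n k) * x) = Complex (u (real (n k) * x)) (v (real (n k) * x))"
  proof -
    have "AE x in lebesgue. f (real (n k) * x) = Complex (u (real (n k) * x)) (v (real (n k) * x))" for k
      using negligible_dilation_preimage[OF Z, of "real (n k)"] npos[of k]
      by (simp add: AE_lebesgue_iff_negligible Z_def)
    then show ?thesis by (simp add: AE_all_countable)
  qed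
  show ?thesis unfolding convergence_system_def
  proof (intro allI impI)
    fix a :: "nat \<Rightarrow> complex"
    assume a: "summable (\<lambda>k. (cmod (a k))\<^sup>2)"
    have ar: "summable (\<lambda>k. (Re (a k))\<^sup>2)" and ai: "summable (\<lambda>k. (Im (a k))\<^sup>2)"
      by (rule summable_comparison_test'[OF a, of 0]; simp add: cmod_power2)+
    from dil conv_u[OF ar] conv_u[OF ai] conv_v[OF ar] conv_v[OF ai]
    show "AE x in lebesgue. summable (\<lambda>k. a k * f (real (n k) * x))"
    proof eventually_elim
      case (elim x)
      then show ?case
        unfolding summable_complex_iff by (simp add: summable_diff summable_add)
    qed
  qed
qed

end
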